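(* Suppose ${\cal A}$ is finite and there is an algorithm deciding whether $i\in G$ for $G\in{\cal G}$ that runs in time linear in $|{\cal A}|$. Then there is a constant $c>0$ (independent of ${\cal A}$) and an algorithm that, given a formula $\phi\in{\cal L}^C_{\cal G}$, decides whether $\phi$ is satisfiable in ${\cal M}_{\cal A}$ (resp. ${\cal M}^r_{\cal A}$) and runs in time $O(|{\cal A}|2^{c|\phi|})$.
   Context: ${\cal G}$ is a set of nonempty subsets of the agent set ${\cal A}$. ${\cal L}^C_{\cal G}$ is the smallest set of formulas containing a set of primitive propositions and closed under $\wedge,\neg$, $K_i$ ($i\in{\cal A}$), $E_G$, $C_G$ ($G\in{\cal G}$). $|\phi|$ is the length of $\phi$, where primitive propositions, $K_i$ and $E_G$ have length 1 and $C_G$ has length 3 independently of $G$. Kripke structures $M=(S,\pi,\{{\cal K}_i\}_{i\in{\cal A}})$ with $(M,s)\models K_i\phi$ iff $\phi$ holds at all ${\cal K}_i$-successors of $s$, $(M,s)\models E_G\phi$ iff $(M,s)\models K_i\phi$ for all $i\in G$, $(M,s)\models C_G\phi$ iff $(M,s)\models E_G^k\phi$ for all $k\ge1$. ${\cal M}_{\cal A}$ is the class of all Kripke structures over ${\cal A}$; ${\cal M}^r_{\cal A}$ those in which every ${\cal K}_i$ is reflexive. *)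

theory Defs
  imports Complex_Main "HOL-Library.Countable_Set"
begin

section \<open>Syntax and semantics\<close>

datatype ('p, 'a) fm =
    Prop 'p
  | Neg "('p, 'a) fm"
  | Conj "('p, 'a) fm" "('p, 'a) fm"
  | Know 'a "('p, 'a) fm"
  | Everyone "'a set" "('p, 'a) fm"
  | Common "'a set" "('p, 'a) fm"

inductive_set lang :: "'p set \<Rightarrow> 'a set \<Rightarrow> 'a set set \<Rightarrow> ('p, 'a) fm set"
  for \<Phi> :: "'p set" and A :: "'a set" and \<G> :: "'a set set" where
  "p \<in> \<Phi> \<Longrightarrow> Prop p \<in> lang \<Phi> A \<G>"
| "\<phi> \<in> lang \<Phi> A \<G> \<Longrightarrow> Neg \<phi> \<in> lang \<Phi> A \<G>"
| "\<phi> \<in> lang \<Phi> A \<G> \<Longrightarrow> \<psi> \<in> lang \<Phi> A \<G> \<Longrightarrow> Conj \<phi> \<psi> \<in> lang \<Phi> A \<G>"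
| "i \<in> A \<Longrightarrow> \<phi> \<in> lang \<Phi> A \<G> \<Longrightarrow> Know i \<phi> \<in> lang \<Phi> A \<G>"
| "G \<in> \<G> \<Longrightarrow> \<phi> \<in> lang \<Phi> A \<G> \<Longrightarrow> Everyone G \<phi> \<in> lang \<Phi> A \<G>"
| "G \<in> \<G> \<Longrightarrow> \<phi> \<in> lang \<Phi> A \<G> \<Longrightarrow> Common G \<phi> \<in> lang \<Phi> A \<G>"

text \<open>Length in symbols, parentheses not counted; \<^const>\<open>Common\<close> has weight 3.\<close>

primrec fm_length :: "('p, 'a) fm \<Rightarrow> nat" where
  "fm_length (Prop p) = 1"
| "fm_length (Neg \<phi>) = 1 + fm_length \<phi>"
| "fm_length (Conj \<phi> \<psi>) = 1 + fm_length \<phi> + fm_length \<psi>"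
| "fm_length (Know i \<phi>) = 1 + fm_length \<phi>"
| "fm_length (Everyone G \<phi>) = 1 + fm_length \<phi>"
| "fm_length (Common G \<phi>) = 3 + fm_length \<phi>"

record ('s, 'p, 'a) kripke =
  states :: "'s set"
  truth_at :: "'s \<Rightarrow> 'p \<Rightarrow> bool"
  acc :: "'a \<Rightarrow> ('s \<times> 's) set"

text \<open>Only the relations \<^term>\<open>acc M i\<close> with \<^term>\<open>i \<in> A\<close> belong to a structure over
  \<^term>\<open>A\<close>; the others are junk values on which nothing depends.\<close>

definition kripke_structures :: "'a set \<Rightarrow> ('s, 'p, 'a) kripke set" where
  "kripke_structures A = {M. \<forall>i\<in>A. acc M i \<subseteq> states M \<times> states M}"

definition reflexive_structures :: "'a set \<Rightarrow> ('s, 'p, 'a) kripke set" where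
  "reflexive_structures A =
     {M \<in> kripke_structures A. \<forall>i\<in>A. refl_on (states M) (acc M i)}"

definition knows :: "('s, 'p, 'a) kripke \<Rightarrow> 'a \<Rightarrow> ('s \<Rightarrow> bool) \<Rightarrow> 's \<Rightarrow> bool" where
  "knows M i X = (\<lambda>s. \<forall>t. (s, t) \<in> acc M i \<longrightarrow> X t)"

definition everyone_knows :: "('s, 'p, 'a) kripke \<Rightarrow> 'a set \<Rightarrow> ('s \<Rightarrow> bool) \<Rightarrow> 's \<Rightarrow> bool" where
  "everyone_knows M G X = (\<lambda>s. \<forall>i\<in>G. knows M i X s)"

primrec sat :: "('s, 'p, 'a) kripke \<Rightarrow> ('p, 'a) fm \<Rightarrow> 's \<Rightarrow> bool" where
  "sat M (Prop p) = (\<lambda>s. truth_at M s p)"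
| "sat M (Neg \<phi>) = (\<lambda>s. \<not> sat M \<phi> s)"
| "sat M (Conj \<phi> \<psi>) = (\<lambda>s. sat M \<phi> s \<and> sat M \<psi> s)"
| "sat M (Know i \<phi>) = knows M i (sat M \<phi>)"
| "sat M (Everyone G \<phi>) = everyone_knows M G (sat M \<phi>)"
| "sat M (Common G \<phi>) = (\<lambda>s. \<forall>k\<ge>1. (everyone_knows M G ^^ k) (sat M \<phi>) s)"

lemma sat_Everyone_funpow:
  "sat M ((Everyone G ^^ k) \<phi>) = (everyone_knows M G ^^ k) (sat M \<phi>)"
  by (induction k) auto

text \<open>The clause for \<^const>\<open>Common\<close> in terms of the formulas $E_G^k \phi$.\<close>

lemma sat_Common_iff:
  "sat M (Common G \<phi>) s \<longleftrightarrow> (\<forall>k\<ge>1. sat M ((Everyone G ^^ k) \<phi>) s)"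
  by (simp add: sat_Everyone_funpow)

definition satisfiable_in :: "('s, 'p, 'a) kripke set \<Rightarrow> ('p, 'a) fm \<Rightarrow> bool" where
  "satisfiable_in \<M> \<phi> \<longleftrightarrow> (\<exists>M\<in>\<M>. \<exists>s\<in>states M. sat M \<phi> s)"


section \<open>Independence of the type of states\<close>

text \<open>A Kripke structure may have an arbitrary set of states, but in HOL the states have to be
  taken from some type. The lemmas below show that every infinite type of states yields
  the same satisfiable formulas (and finite types yield no further ones), by restricting a
  structure to a countable set of states that is closed under witnesses.\<close>

primrec tested :: "('s, 'p, 'a) kripke \<Rightarrow> ('p, 'a) fm \<Rightarrow> ('s \<Rightarrow> bool) set" where
  "tested M (Prop p) = {}"
| "tested M (Neg \<phi>) = tested M \<phi>"
| "tested M (Conj \<phi> \<psi>) = tested M \<phi> \<union> tested M \<psi>"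
| "tested M (Know i \<phi>) = insert (sat M \<phi>) (tested M \<phi>)"
| "tested M (Everyone G \<phi>) = insert (sat M \<phi>) (tested M \<phi>)"
| "tested M (Common G \<phi>) = range (\<lambda>k. (everyone_knows M G ^^ k) (sat M \<phi>)) \<union> tested M \<phi>"

lemma countable_tested: "countable (tested M \<phi>)"
  by (induction \<phi>) auto

definition restrict_along ::
  "('s \<Rightarrow> 't) \<Rightarrow> 's set \<Rightarrow> ('s, 'p, 'a) kripke \<Rightarrow> ('t, 'p, 'a) kripke" where
  "restrict_along h T M =
     \<lparr>states = h ` T, truth_at = (\<lambda>t. truth_at M (inv_into T h t)),
      acc = (\<lambda>i. {(h u, h v) | u v. u \<in> T \<and> v \<in> T \<and> (u, v) \<in> acc M i})\<rparr>"

lemma knows_restrict_along: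
  assumes inj: "inj_on h T" and s: "s \<in> T"
    and X: "\<And>t. t \<in> T \<Longrightarrow> Y (h t) \<longleftrightarrow> X t"
    and wit: "\<not> knows M i X s \<Longrightarrow> \<exists>u\<in>T. (s, u) \<in> acc M i \<and> \<not> X u"
  shows "knows (restrict_along h T M) i Y (h s) \<longleftrightarrow> knows M i X s"
proof
  assume L: "knows (restrict_along h T M) i Y (h s)"
  show "knows M i X s"
  proof (rule ccontr)
    assume "\<not> knows M i X s"
    then obtain u where "u \<in> T" "(s, u) \<in> acc M i" "\<not> X u" using wit by blast
    with L s X show False by (auto simp: knows_def restrict_along_def)
  qed
next
  assume R: "knows M i X s"
  show "knows (restrict_along h T M) i Y (h s)"
    using R inj s X by (auto simp: knows_def restrict_along_def dest: inj_onD)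
qed

lemma sat_restrict_along:
  assumes inj: "inj_on h T"
    and \<G>: "\<And>G. G \<in> \<G> \<Longrightarrow> G \<subseteq> A"
    and wit: "\<And>i X s. i \<in> A \<Longrightarrow> X \<in> W \<Longrightarrow> s \<in> T \<Longrightarrow> \<not> knows M i X s
               \<Longrightarrow> \<exists>u\<in>T. (s, u) \<in> acc M i \<and> \<not> X u"
    and \<phi>: "\<phi> \<in> lang \<Phi> A \<G>"
  shows "tested M \<phi> \<subseteq> W \<Longrightarrow> s \<in> T \<Longrightarrow> sat (restrict_along h T M) \<phi> (h s) \<longleftrightarrow> sat M \<phi> s"
  using \<phi>
proof (induction arbitrary: s rule: lang.induct)
  case (1 p)
  then show ?case using inj by (simp add: restrict_along_def)
next
  case (4 i \<phi>)
  have "knows (restrict_along h T M) i (sat (restrict_along h T M) \<phi>) (h s)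
          \<longleftrightarrow> knows M i (sat M \<phi>) s"
    using 4 by (intro knows_restrict_along[OF inj] wit) auto
  then show ?case by simp
next
  case (5 G \<phi>)
  have "knows (restrict_along h T M) i (sat (restrict_along h T M) \<phi>) (h s)
          \<longleftrightarrow> knows M i (sat M \<phi>) s" if "i \<in> G" for i
    using 5 \<G> that by (intro knows_restrict_along[OF inj] wit) auto
  then show ?case by (simp add: everyone_knows_def)
next
  case (6 G \<phi>)
  have "(everyone_knows (restrict_along h T M) G ^^ k) (sat (restrict_along h T M) \<phi>) (h s)
          \<longleftrightarrow> (everyone_knows M G ^^ k) (sat M \<phi>) s" if "s \<in> T" for k s
    using that
  proof (induction k arbitrary: s)
    case 0
    then show ?case using 6 by simp
  next
    case (Suc k)
    have "knows (restrict_along h T M) i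
            ((everyone_knows (restrict_along h T M) G ^^ k) (sat (restrict_along h T M) \<phi>)) (h s)
          \<longleftrightarrow> knows M i ((everyone_knows M G ^^ k) (sat M \<phi>)) s" if "i \<in> G" for i
      using 6 Suc \<G> that by (intro knows_restrict_along[OF inj] wit) auto
    then show ?case by (simp add: everyone_knows_def[of _ _ "(_ ^^ _) _"])
  qed
  then show ?case using 6 by simp
qed auto

lemma countable_witness_closure:
  fixes M :: "('s, 'p, 'a :: countable) kripke"
  assumes M: "M \<in> kripke_structures A" and s: "s \<in> states M" and W: "countable W"
  obtains T where "countable T" "s \<in> T" "T \<subseteq> states M"
    "\<And>i X t. i \<in> A \<Longrightarrow> X \<in> W \<Longrightarrow> t \<in> T \<Longrightarrow> \<not> knows M i X t
       \<Longrightarrow> \<exists>u\<in>T. (t, u) \<in> acc M i \<and> \<not> X u"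
proof -
  define w where "w i X t = (SOME u. (t, u) \<in> acc M i \<and> \<not> X u)" for i X t
  have w: "(t, w i X t) \<in> acc M i \<and> \<not> X (w i X t)" if "\<not> knows M i X t" for i X t
    using that unfolding w_def knows_def by (metis (mono_tags, lifting) someI_ex)
  define step where
    "step T = (\<lambda>(i, X, t). w i X t) ` ((A \<times> W \<times> T) \<inter> {(i, X, t). \<not> knows M i X t})" for T
  define T where "T n = (step ^^ n) {s}" for n
  have T_Suc: "T (Suc n) = step (T n)" for n by (simp add: T_def)
  have cnt: "countable (T n)" for n
  proof (induction n)
    case (Suc n)
    then show ?case unfolding T_Suc step_def
      using W by (intro countable_image countable_Int1 countable_SIGMA) auto
  qed (simp add: T_def)
  have sub: "T n \<subseteq> states M" for n
  proof (induction n)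
    case (Suc n)
    then show ?case unfolding T_Suc step_def
      using w M by (fastforce simp: kripke_structures_def)
  qed (simp add: T_def s)
  show thesis
  proof (rule that[of "\<Union>n. T n"])
    show "countable (\<Union>n. T n)" using cnt by auto
    show "s \<in> (\<Union>n. T n)" by (rule UN_I[of 0]) (auto simp: T_def)
    show "(\<Union>n. T n) \<subseteq> states M" using sub by auto
    fix i X t
    assume "i \<in> A" "X \<in> W" "t \<in> (\<Union>n. T n)" "\<not> knows M i X t"
    then obtain n where "t \<in> T n" by auto
    have "w i X t \<in> T (Suc n)" unfolding T_Suc step_def
      using \<open>i \<in> A\<close> \<open>X \<in> W\<close> \<open>t \<in> T n\<close> \<open>\<not> knows M i X t\<close>
      by (intro image_eqI[where x = "(i, X, t)"]) auto
    with w[OF \<open>\<not> knows M i X t\<close>]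
    show "\<exists>u\<in>\<Union>n. T n. (t, u) \<in> acc M i \<and> \<not> X u" by blast
  qed
qed

lemma countable_inj_into_infinite:
  assumes "countable T" "infinite (UNIV :: 't set)"
  obtains h :: "'s \<Rightarrow> 't" where "inj_on h T"
proof -
  obtain f :: "nat \<Rightarrow> 't" where "inj f"
    using assms(2) infinite_countable_subset by blast
  moreover obtain g :: "'s \<Rightarrow> nat" where "inj_on g T" using assms(1) countableE by blast
  ultimately have "inj_on (f \<circ> g) T" by (meson comp_inj_on inj_on_subset subset_UNIV)
  then show thesis by (rule that)
qed

lemma satisfiable_in_transfer:
  fixes \<phi> :: "('p, 'a :: countable) fm"
  assumes inf: "infinite (UNIV :: 't set)"
    and \<G>: "\<And>G. G \<in> \<G> \<Longrightarrow> G \<subseteq> A"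
    and \<phi>: "\<phi> \<in> lang \<Phi> A \<G>"
  shows "satisfiable_in (kripke_structures A :: ('s, 'p, 'a) kripke set) \<phi>
           \<Longrightarrow> satisfiable_in (kripke_structures A :: ('t, 'p, 'a) kripke set) \<phi>" (is "?k \<Longrightarrow> ?k'")
    and "satisfiable_in (reflexive_structures A :: ('s, 'p, 'a) kripke set) \<phi>
           \<Longrightarrow> satisfiable_in (reflexive_structures A :: ('t, 'p, 'a) kripke set) \<phi>" (is "?r \<Longrightarrow> ?r'")
proof -
  have key: "\<exists>M' :: ('t, 'p, 'a) kripke. M' \<in> kripke_structures A
      \<and> (M \<in> reflexive_structures A \<longrightarrow> M' \<in> reflexive_structures A)
      \<and> (\<exists>t\<in>states M'. sat M' \<phi> t)"
    if M: "M \<in> kripke_structures A" and s: "s \<in> states M" "sat M \<phi> s"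
    for M :: "('s, 'p, 'a) kripke" and s
  proof -
    obtain T where T: "countable T" "s \<in> T" "T \<subseteq> states M"
      and wit: "\<And>i X t. i \<in> A \<Longrightarrow> X \<in> tested M \<phi> \<Longrightarrow> t \<in> T \<Longrightarrow> \<not> knows M i X t
           \<Longrightarrow> \<exists>u\<in>T. (t, u) \<in> acc M i \<and> \<not> X u"
      using countable_witness_closure[OF M s(1) countable_tested] by metis
    obtain h :: "'s \<Rightarrow> 't" where h: "inj_on h T"
      using countable_inj_into_infinite[OF T(1) inf] by blast
    have "sat (restrict_along h T M) \<phi> (h s) \<longleftrightarrow> sat M \<phi> s"
    proof (rule sat_restrict_along[where W = "tested M \<phi>", OF h _ _ \<phi> subset_refl T(2)])
      show "G \<subseteq> A" if "G \<in> \<G>" for G using that by (rule \<G>)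
      show "\<exists>u\<in>T. (t, u) \<in> acc M i \<and> \<not> X u"
        if "i \<in> A" "X \<in> tested M \<phi>" "t \<in> T" "\<not> knows M i X t" for i X t
        using that by (rule wit)
    qed
    then have "sat (restrict_along h T M) \<phi> (h s)" using s(2) by (rule iffD2)
    moreover have "h s \<in> states (restrict_along h T M)"
      using T(2) by (simp add: restrict_along_def)
    moreover have k: "restrict_along h T M \<in> kripke_structures A"
      by (auto simp: kripke_structures_def restrict_along_def)
    moreover have "restrict_along h T M \<in> reflexive_structures A"
      if "M \<in> reflexive_structures A"
    proof -
      have "(h t, h t) \<in> acc (restrict_along h T M) i" if "i \<in> A" "t \<in> T" for i t
      proof -
        have "(t, t) \<in> acc M i"
          using that T(3) \<open>M \<in> reflexive_structures A\<close>
          by (auto simp: reflexive_structures_def refl_on_def)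
        with that(2) show ?thesis by (simp add: restrict_along_def) blast
      qed
      then show ?thesis
        using k by (auto simp: reflexive_structures_def refl_on_def restrict_along_def)
    qed
    ultimately show ?thesis by blast
  qed
  show "?k \<Longrightarrow> ?k'" unfolding satisfiable_in_def by (meson key)
  have "M \<in> kripke_structures A" if "M \<in> reflexive_structures A"
    for M :: "('s, 'p, 'a) kripke"
    using that by (simp add: reflexive_structures_def)
  then show "?r \<Longrightarrow> ?r'" unfolding satisfiable_in_def by (meson key)
qed

theorem satisfiable_in_state_type_irrelevant:
  fixes \<phi> :: "('p, 'a :: countable) fm"
  assumes "infinite (UNIV :: 's set)" "infinite (UNIV :: 't set)"
    and "\<And>G. G \<in> \<G> \<Longrightarrow> G \<subseteq> A" and "\<phi> \<in> lang \<Phi> A \<G>"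
  shows "satisfiable_in (kripke_structures A :: ('s, 'p, 'a) kripke set) \<phi>
           \<longleftrightarrow> satisfiable_in (kripke_structures A :: ('t, 'p, 'a) kripke set) \<phi>"
    and "satisfiable_in (reflexive_structures A :: ('s, 'p, 'a) kripke set) \<phi>
           \<longleftrightarrow> satisfiable_in (reflexive_structures A :: ('t, 'p, 'a) kripke set) \<phi>"
  using satisfiable_in_transfer[OF assms(1,3,4)] satisfiable_in_transfer[OF assms(2,3,4)] by blast+


section \<open>Algorithms and running time\<close>

text \<open>The model of computation is first-order pure Lisp with call by value: the data are binary
  trees with natural numbers at the leaves, and a program is a finite list of mutually
  recursive function definitions, the first of which is the main function. Every
  evaluation step has unit cost. Since trees can be shared, one step takes constant
  time on a unit-cost RAM with addition and subtraction. There is no multiplication, so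
  numbers grow by at most one bit per step and unit cost is reasonable.\<close>

datatype data = Num nat | Cell data data

datatype prim = CONS | FST | SND | IS_NUM | EQ | LESS | ADD | SUB

fun apply_prim :: "prim \<Rightarrow> data list \<Rightarrow> data option" where
  "apply_prim CONS [x, y] = Some (Cell x y)"
| "apply_prim FST [Cell x y] = Some x"
| "apply_prim SND [Cell x y] = Some y"
| "apply_prim IS_NUM [x] = Some (Num (case x of Num _ \<Rightarrow> 1 | Cell _ _ \<Rightarrow> 0))"
| "apply_prim EQ [Num m, Num n] = Some (Num (if m = n then 1 else 0))"
| "apply_prim LESS [Num m, Num n] = Some (Num (if m < n then 1 else 0))"
| "apply_prim ADD [Num m, Num n] = Some (Num (m + n))"
| "apply_prim SUB [Num m, Num n] = Some (Num (m - n))"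
| "apply_prim _ _ = None"

text \<open>Variables are de Bruijn indices into the environment: \<^term>\<open>Var 0\<close> is the first argument of
  the current function or the innermost variable bound by \<open>Bind\<close>. \<open>Call f\<close> calls the
  \<open>f\<close>-th function of the program. \<open>Cond\<close> takes its last branch exactly if the test
  yields \<^term>\<open>Num 0\<close>.\<close>

datatype expr =
    Var nat
  | Lit nat
  | Prim prim "expr list"
  | Cond expr expr expr
  | Bind expr expr
  | Call nat "expr list"

type_synonym prog = "expr list"

text \<open>\<^term>\<open>eval P env e v n\<close>: in program \<^term>\<open>P\<close> and environment \<^term>\<open>env\<close>, evaluating \<^term>\<open>e\<close> halts
  after \<^term>\<open>n\<close> steps with value \<^term>\<open>v\<close>.\<close>

inductive eval :: "prog \<Rightarrow> data list \<Rightarrow> expr \<Rightarrow> data \<Rightarrow> nat \<Rightarrow> bool"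
  and evals :: "prog \<Rightarrow> data list \<Rightarrow> expr list \<Rightarrow> data list \<Rightarrow> nat \<Rightarrow> bool"
  for P :: prog where
  Var: "x < length env \<Longrightarrow> eval P env (Var x) (env ! x) 1"
| Lit: "eval P env (Lit m) (Num m) 1"
| Prim: "evals P env es vs n \<Longrightarrow> apply_prim f vs = Some v \<Longrightarrow> eval P env (Prim f es) v (1 + n)"
| CondT: "eval P env b u m \<Longrightarrow> u \<noteq> Num 0 \<Longrightarrow> eval P env e1 v n
    \<Longrightarrow> eval P env (Cond b e1 e2) v (1 + m + n)"
| CondF: "eval P env b (Num 0) m \<Longrightarrow> eval P env e2 v n
    \<Longrightarrow> eval P env (Cond b e1 e2) v (1 + m + n)"
| Bind: "eval P env e1 u m \<Longrightarrow> eval P (u # env) e2 v n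
    \<Longrightarrow> eval P env (Bind e1 e2) v (1 + m + n)"
| Call: "evals P env es vs m \<Longrightarrow> f < length P \<Longrightarrow> eval P vs (P ! f) v n
    \<Longrightarrow> eval P env (Call f es) v (1 + m + n)"
| Nil: "evals P env [] [] 0"
| Cons: "eval P env e v m \<Longrightarrow> evals P env es vs n
    \<Longrightarrow> evals P env (e # es) (v # vs) (m + n)"

lemma eval_deterministic:
  "eval P env e v n \<Longrightarrow> eval P env e v' n' \<Longrightarrow> v' = v \<and> n' = n"
  "evals P env es vs n \<Longrightarrow> evals P env es vs' n' \<Longrightarrow> vs' = vs \<and> n' = n"
proof (induction arbitrary: v' n' and vs' n' rule: eval_evals.inducts)
  case (Var x env)
  from Var(2) show ?case by cases auto
next
  case (Lit env m)
  from Lit show ?case by cases auto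
next
  case (Prim env es vs n f v)
  from Prim(4) show ?case by cases (use Prim(3) in \<open>auto dest!: Prim(2)\<close>)
next
  case (CondT env b u m e1 v n e2)
  from CondT(6) show ?case by cases (use CondT(5) in \<open>auto dest!: CondT(2,4)\<close>)
next
  case (CondF env b m e2 v n e1)
  from CondF(5) show ?case by cases (use CondF(1) in \<open>auto dest!: CondF(2,4)\<close>)
next
  case (Bind env e1 u m e2 v n)
  from Bind(5) show ?case by cases (use Bind(1) in \<open>auto dest!: Bind(2,4)\<close>)
next
  case (Call env es vs m f v n)
  from Call(6) show ?case by cases (use Call(3) in \<open>auto dest!: Call(2,5)\<close>)
next
  case (Nil env)
  from Nil show ?case by cases auto
next
  case (Cons env e v m es vs n)
  from Cons(5) show ?case by cases (use Cons(1) in \<open>auto dest!: Cons(2,4)\<close>)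
qed

definition runs :: "prog \<Rightarrow> data \<Rightarrow> data \<Rightarrow> nat \<Rightarrow> bool" where
  "runs P x v n \<longleftrightarrow> P \<noteq> [] \<and> eval P [x] (P ! 0) v n"

definition decides_in_time ::
  "prog \<Rightarrow> 'x set \<Rightarrow> ('x \<Rightarrow> data) \<Rightarrow> ('x \<Rightarrow> bool) \<Rightarrow> ('x \<Rightarrow> real) \<Rightarrow> bool" where
  "decides_in_time P X enc R time \<longleftrightarrow>
     (\<forall>x\<in>X. \<exists>n. runs P (enc x) (Num (if R x then 1 else 0)) n \<and> real n \<le> time x)"

text \<open>Agents and primitive propositions are natural numbers, and \<^term>\<open>name G\<close> is the number by which
  a group \<^term>\<open>G\<close> is referred to in inputs. All of them are atomic symbols, in accordance
  with their contribution to \<^const>\<open>fm_length\<close>.\<close>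

definition encode_query :: "(nat set \<Rightarrow> nat) \<Rightarrow> nat \<times> nat set \<Rightarrow> data" where
  "encode_query name = (\<lambda>(i, G). Cell (Num i) (Num (name G)))"

primrec encode_fm :: "(nat set \<Rightarrow> nat) \<Rightarrow> (nat, nat) fm \<Rightarrow> data" where
  "encode_fm name (Prop p) = Cell (Num 0) (Num p)"
| "encode_fm name (Neg \<phi>) = Cell (Num 1) (encode_fm name \<phi>)"
| "encode_fm name (Conj \<phi> \<psi>) = Cell (Num 2) (Cell (encode_fm name \<phi>) (encode_fm name \<psi>))"
| "encode_fm name (Know i \<phi>) = Cell (Num 3) (Cell (Num i) (encode_fm name \<phi>))"
| "encode_fm name (Everyone G \<phi>) = Cell (Num 4) (Cell (Num (name G)) (encode_fm name \<phi>))"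
| "encode_fm name (Common G \<phi>) = Cell (Num 5) (Cell (Num (name G)) (encode_fm name \<phi>))"

end

theory Submission
  imports Defs "HOL-Library.Nat_Bijection"
begin

text \<open>Treat \<open>K\<^sub>i\<close> as the box of the group \<open>{i}\<close>. A state is a set of propositions and modal
  subformulas of \<open>\<phi>\<close>, and an agent \<open>i\<close> may lead from \<open>s\<close> to \<open>t\<close> unless some modal formula in \<open>s\<close>
  whose group contains \<open>i\<close> is violated at \<open>t\<close>. Starting from all states, which are at most
  \<open>2 ^ |\<phi>|\<close> many, repeatedly delete those where some modal formula is false without a
  refuting path; \<open>\<phi>\<close> is satisfiable iff a state survives in which \<open>\<phi>\<close> holds. For reflexive
  structures, only states that every agent may lead to themselves are admitted initially.

  To keep the running time linear in the number of agents, the agents are never enumerated.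
  That some \<open>i\<close> in \<open>G\<close> leads from \<open>s\<close> to \<open>t\<close> means that \<open>G\<close> minus the groups of the violated
  formulas is nonempty. As the program may depend on \<open>A\<close>, \<open>\<G>\<close> and \<open>name\<close>, the difference of two
  subsets of \<open>A\<close>, coded by numbers, is read off a decision tree of depth \<open>O(|A|)\<close> that is wired
  into the program.\<close>

section \<open>Elimination of states\<close>

fun modal :: "('p, 'a) fm \<Rightarrow> bool" where
  "modal (Know i \<phi>) = True"
| "modal (Everyone G \<phi>) = True"
| "modal (Common G \<phi>) = True"
| "modal _ = False"

fun common :: "('p, 'a) fm \<Rightarrow> bool" where
  "common (Common G \<phi>) = True"
| "common _ = False"

fun group :: "('p, 'a) fm \<Rightarrow> 'a set" where
  "group (Know i \<phi>) = {i}"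
| "group (Everyone G \<phi>) = G"
| "group (Common G \<phi>) = G"
| "group _ = {}"

fun arg :: "('p, 'a) fm \<Rightarrow> ('p, 'a) fm" where
  "arg (Know i \<phi>) = \<phi>"
| "arg (Everyone G \<phi>) = \<phi>"
| "arg (Common G \<phi>) = \<phi>"
| "arg \<phi> = \<phi>"

text \<open>\<open>C\<^sub>G \<phi>\<close> is equivalent to \<open>E\<^sub>G (\<phi> \<and> C\<^sub>G \<phi>)\<close>.\<close>

definition obligation :: "('p, 'a) fm \<Rightarrow> ('p, 'a) fm" where
  "obligation f = (if common f then Conj (arg f) f else arg f)"

text \<open>Boolean subformulas are left out, as \<open>holds\<close> recovers their truth from the
  other subformulas. Repeated occurrences are kept: a state is only read as a set, and the list is
  still no longer than the formula.\<close>

primrec elems :: "('p, 'a) fm \<Rightarrow> ('p, 'a) fm list" where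
  "elems (Prop p) = [Prop p]"
| "elems (Neg \<phi>) = elems \<phi>"
| "elems (Conj \<phi> \<psi>) = elems \<phi> @ elems \<psi>"
| "elems (Know i \<phi>) = Know i \<phi> # elems \<phi>"
| "elems (Everyone G \<phi>) = Everyone G \<phi> # elems \<phi>"
| "elems (Common G \<phi>) = Common G \<phi> # elems \<phi>"

text \<open>A state is the list of the propositions and modal formulas that are true there.\<close>

fun holds :: "('p, 'a) fm list \<Rightarrow> ('p, 'a) fm \<Rightarrow> bool" where
  "holds s (Neg \<phi>) \<longleftrightarrow> \<not> holds s \<phi>"
| "holds s (Conj \<phi> \<psi>) \<longleftrightarrow> holds s \<phi> \<and> holds s \<psi>"
| "holds s f \<longleftrightarrow> f \<in> set s"

fun labels :: "'a set \<Rightarrow> ('p, 'a) fm list \<Rightarrow> ('p, 'a) fm list \<Rightarrow> 'a set" where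
  "labels c [] t = c"
| "labels c (f # s) t =
     labels (if modal f \<and> \<not> holds t (obligation f) then c - group f else c) s t"

lemma in_labels_iff:
  "i \<in> labels c s t \<longleftrightarrow>
     i \<in> c \<and> (\<forall>f\<in>set s. modal f \<and> i \<in> group f \<longrightarrow> holds t (obligation f))"
  by (induction s arbitrary: c) auto

lemma labels_subset: "labels c s t \<subseteq> c"
  by (auto simp: in_labels_iff)

definition hits ::
  "'a set \<Rightarrow> ('p, 'a) fm list \<Rightarrow> ('p, 'a) fm list list \<Rightarrow> bool" where
  "hits c s Y \<longleftrightarrow> (\<exists>t\<in>set Y. labels c s t \<noteq> {})"

text \<open>These are the states with a path to \<open>Y\<close> of at most \<open>k\<close> steps
  through \<open>W\<close>, each step made by some agent of \<open>c\<close>. Every stage is rebuilt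
  from \<open>W\<close> and \<open>Y\<close>, so the lists do not keep growing with
  \<open>k\<close>.\<close>

primrec reach ::
  "'a set \<Rightarrow> ('p, 'a) fm list list \<Rightarrow> ('p, 'a) fm list list \<Rightarrow> nat \<Rightarrow> ('p, 'a) fm list list" where
  "reach c W Y 0 = Y"
| "reach c W Y (Suc k) = filter (\<lambda>u. hits c u (reach c W Y k)) W @ Y"

text \<open>A refuting path has at least one step, which is the outer \<open>hits\<close>; only for
  \<open>Common\<close> may further steps follow, and \<open>length W\<close> of them are
  enough.\<close>

definition refuted ::
  "('p, 'a) fm list list \<Rightarrow> ('p, 'a) fm list \<Rightarrow> ('p, 'a) fm \<Rightarrow> bool" where
  "refuted W s f \<longleftrightarrow>
     hits (group f) s
       (reach (group f) W (filter (\<lambda>t. \<not> holds t (arg f)) W) (if common f then length W else 0))"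

text \<open>Only modal formulas absent from \<open>s\<close> are tested: those present are enforced
  by \<open>labels\<close>, which forbids every transition that would violate them.\<close>

definition fulfilled ::
  "('p, 'a) fm list \<Rightarrow> ('p, 'a) fm list list \<Rightarrow> ('p, 'a) fm list \<Rightarrow> bool" where
  "fulfilled L W s \<longleftrightarrow> (\<forall>f\<in>set L. modal f \<longrightarrow> f \<in> set s \<or> refuted W s f)"

primrec eliminate ::
  "nat \<Rightarrow> ('p, 'a) fm list \<Rightarrow> ('p, 'a) fm list list \<Rightarrow> ('p, 'a) fm list list" where
  "eliminate 0 L W = W"
| "eliminate (Suc k) L W = eliminate k L (filter (fulfilled L W) W)"

primrec sublists :: "'b list \<Rightarrow> 'b list list" where
  "sublists [] = [[]]"
| "sublists (x # xs) = map ((#) x) (sublists xs) @ sublists xs"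

text \<open>The condition says that each agent in \<open>R\<close> may lead from \<open>s\<close> to itself; it is void for \<open>R = {}\<close>.\<close>

definition candidates :: "'a set \<Rightarrow> ('p, 'a) fm list \<Rightarrow> ('p, 'a) fm list list" where
  "candidates R L = filter (\<lambda>s. labels R s s = R) (sublists L)"

definition survivors :: "'a set \<Rightarrow> ('p, 'a) fm \<Rightarrow> ('p, 'a) fm list list" where
  "survivors R \<phi> = (let W = candidates R (elems \<phi>) in eliminate (length W) (elems \<phi>) W)"

section \<open>Stabilization of elimination and reachability\<close>

lemma length_sublists: "length (sublists xs) = 2 ^ length xs"
  by (induction xs) auto

lemma filter_in_sublists: "filter p xs \<in> set (sublists xs)"
  by (induction xs) auto

lemma sublists_bounds: "s \<in> set (sublists xs) \<Longrightarrow> set s \<subseteq> set xs \<and> length s \<le> length xs"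
  by (induction xs arbitrary: s) fastforce+

lemma eliminate_subset: "set (eliminate k L W) \<subseteq> set W"
proof (induction k arbitrary: W)
  case (Suc k)
  then show ?case by (simp add: subset_trans[OF Suc.IH])
qed simp

text \<open>A round either changes nothing or shortens the list, so \<open>length W\<close> rounds
  end in a fixed point.\<close>

lemma eliminate_stable:
  "length W \<le> k \<Longrightarrow> s \<in> set (eliminate k L W) \<Longrightarrow> fulfilled L (eliminate k L W) s"
proof (induction k arbitrary: W)
  case (Suc k)
  show ?case
  proof (cases "filter (fulfilled L W) W = W")
    case True
    then have "eliminate j L W = W" for j by (induction j) auto
    with True Suc.prems show ?thesis by (metis filter_id_conv)
  next
    case False
    then have "length (filter (fulfilled L W) W) < length W"
      by (metis filter_id_conv length_filter_less)
    with Suc show ?thesis by simp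
  qed
qed simp

lemma reach_subset: "set Y \<subseteq> set W \<Longrightarrow> set (reach c W Y k) \<subseteq> set W"
  by (cases k) auto

lemma hits_mono: "hits c u Y \<Longrightarrow> set Y \<subseteq> set Z \<Longrightarrow> hits c u Z"
  by (auto simp: hits_def)

lemma reach_Suc_mono: "set (reach c W Y k) \<subseteq> set (reach c W Y (Suc k))"
proof (induction k)
  case (Suc k)
  then have "hits c u (reach c W Y (Suc k))" if "hits c u (reach c W Y k)" for u
    using hits_mono that by blast
  then show ?case by auto
qed auto

text \<open>The sets are increasing, and once two consecutive ones agree they stay the same.\<close>

lemma reach_length:
  assumes "set Y \<subseteq> set W"
  shows "set (reach c W Y k) \<subseteq> set (reach c W Y (length W))"
proof -
  let ?X = "\<lambda>k. set (reach c W Y k)"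
  have mono: "mono ?X" by (rule mono_iff_le_Suc[THEN iffD2]) (blast intro: reach_Suc_mono[THEN subsetD])
  have "?X (Suc k) = ?X (Suc (Suc k))" if "?X k = ?X (Suc k)" for k
  proof -
    have eq: "(\<lambda>u. hits c u (reach c W Y k)) = (\<lambda>u. hits c u (reach c W Y (Suc k)))"
      using that unfolding hits_def by metis
    show ?thesis unfolding reach.simps(2)[of c W Y "Suc k"] eq[symmetric] by simp
  qed
  moreover have "finite (range ?X)"
    by (rule finite_subset[of _ "Pow (set W)"]) (use reach_subset[OF assms] in auto)
  ultimately have "\<exists>N. (\<forall>n\<le>N. \<forall>m\<le>N. m < n \<longrightarrow> ?X m \<subset> ?X n) \<and> (\<forall>n\<ge>N. ?X N = ?X n)"
    using mono by (intro finite_mono_remains_stable_implies_strict_prefix) blast+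
  then have "?X (card (set W)) = (\<Union>n. ?X n)"
    by (intro finite_mono_strict_prefix_implies_finite_fixpoint reach_subset[OF assms]) auto
  moreover have "?X (card (set W)) \<subseteq> ?X (length W)"
    using mono card_length by (auto simp: mono_def)
  ultimately show ?thesis by auto
qed

section \<open>Semantics of modal formulas by groups and obligations\<close>

definition structures :: "'a set \<Rightarrow> 'a set \<Rightarrow> ('s, 'p, 'a) kripke set" where
  "structures A R = {M \<in> kripke_structures A. \<forall>i\<in>R. refl_on (states M) (acc M i)}"

lemma structures_empty: "structures A {} = kripke_structures A"
  by (simp add: structures_def)

lemma structures_full: "structures A A = reflexive_structures A"
  by (simp add: structures_def reflexive_structures_def)

lemma elems_arg: "modal f \<Longrightarrow> f \<in> set (elems \<phi>) \<Longrightarrow> set (elems (arg f)) \<subseteq> set (elems \<phi>)"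
  by (induction \<phi>) auto

lemma elems_self: "modal f \<Longrightarrow> set (elems f) = insert f (set (elems (arg f)))"
  by (cases f) auto

lemma elems_obligation:
  "modal f \<Longrightarrow> f \<in> set (elems \<phi>) \<Longrightarrow> set (elems (obligation f)) \<subseteq> set (elems \<phi>)"
  using elems_arg[of f \<phi>] elems_self[of f] by (auto simp: obligation_def)

lemma elems_lang: "\<phi> \<in> lang \<Phi> A \<G> \<Longrightarrow> f \<in> set (elems \<phi>) \<Longrightarrow> f \<in> lang \<Phi> A \<G>"
  by (induction rule: lang.induct) (auto intro: lang.intros)

lemma group_lang:
  assumes "f \<in> lang \<Phi> A \<G>" and "\<And>G. G \<in> \<G> \<Longrightarrow> G \<subseteq> A"
  shows "group f \<subseteq> A"
  using assms by cases auto

lemma everyone_knows_iff: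
  "everyone_knows M G X s \<longleftrightarrow> (\<forall>i\<in>G. \<forall>t. (s, t) \<in> acc M i \<longrightarrow> X t)"
  by (simp add: everyone_knows_def knows_def)

lemma funpow_everyone_knows_Suc:
  "(everyone_knows M G ^^ Suc k) X s \<longleftrightarrow>
     (\<forall>i\<in>G. \<forall>t. (s, t) \<in> acc M i \<longrightarrow> (everyone_knows M G ^^ k) X t)"
  by (simp add: everyone_knows_iff)

lemma sat_Common_Suc:
  "sat M (Common G \<phi>) s \<longleftrightarrow> (\<forall>k. (everyone_knows M G ^^ Suc k) (sat M \<phi>) s)"
  by (simp del: funpow.simps) (metis Suc_le_D Suc_le_mono zero_le)

text \<open>The operator \<open>everyone_knows M G\<close> commutes with the conjunction over all
  \<open>k\<close>, so the first of \<open>k + 1\<close> steps can be split off; what remains for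
  \<open>k = 0\<close> is \<open>\<phi>\<close> itself.\<close>

lemma sat_Common_unfold:
  "sat M (Common G \<phi>) s \<longleftrightarrow> everyone_knows M G (sat M (Conj \<phi> (Common G \<phi>))) s"
proof -
  have "(\<forall>k. (everyone_knows M G ^^ k) X t) \<longleftrightarrow> X t \<and> (\<forall>k. (everyone_knows M G ^^ Suc k) X t)" for X t
    by (metis (no_types) funpow_0 not0_implies_Suc)
  then have "sat M (Conj \<phi> (Common G \<phi>)) t \<longleftrightarrow> (\<forall>k. (everyone_knows M G ^^ k) (sat M \<phi>) t)" for t
    by (simp only: sat.simps(3) sat_Common_Suc)
  then show ?thesis
    by (simp only: everyone_knows_iff sat_Common_Suc funpow_everyone_knows_Suc) blast
qed

text \<open>This lets the three modalities share one treatment of true formulas; for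
  \<open>Common\<close> it is the unfolding above.\<close>

lemma sat_modal:
  "modal f \<Longrightarrow> sat M f s \<longleftrightarrow> everyone_knows M (group f) (sat M (obligation f)) s"
proof (cases f)
  case (Common G \<phi>)
  then show ?thesis
    unfolding obligation_def using sat_Common_unfold[of M G \<phi> s] by simp
qed (auto simp: obligation_def everyone_knows_def)

section \<open>The types realized in a structure survive\<close>

context
  fixes M :: "('s, 'p, 'a) kripke" and \<phi> :: "('p, 'a) fm" and A R :: "'a set"
  assumes M: "M \<in> structures A R"
    and grp: "\<And>f. f \<in> set (elems \<phi>) \<Longrightarrow> group f \<subseteq> A"
begin

text \<open>Filtering keeps the order of \<open>elems \<phi>\<close>, so the resulting list occurs
  among its \<open>sublists\<close>.\<close>

definition type_of :: "'s \<Rightarrow> ('p, 'a) fm list" where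
  "type_of u = filter (\<lambda>f. sat M f u) (elems \<phi>)"

lemma holds_type_of: "set (elems \<psi>) \<subseteq> set (elems \<phi>) \<Longrightarrow> holds (type_of u) \<psi> \<longleftrightarrow> sat M \<psi> u"
  by (induction \<psi>) (auto simp: type_of_def)

text \<open>By \<open>sat_modal\<close>, the obligations of the modal formulas true at
  \<open>u\<close> are true at \<open>v\<close>, so no group containing \<open>i\<close> is
  subtracted.\<close>

lemma labels_type_of:
  assumes "(u, v) \<in> acc M i" "i \<in> c"
  shows "i \<in> labels c (type_of u) (type_of v)"
proof -
  have "holds (type_of v) (obligation f)"
    if "f \<in> set (type_of u)" "modal f" "i \<in> group f" for f
  proof -
    have f: "f \<in> set (elems \<phi>)" "sat M f u" using that by (auto simp: type_of_def)
    then have "sat M (obligation f) v"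
      using sat_modal that assms(1) by (fastforce simp: everyone_knows_def knows_def)
    with elems_obligation[OF that(2) f(1)] show ?thesis by (simp add: holds_type_of)
  qed
  with assms show ?thesis by (auto simp: in_labels_iff)
qed

lemma acc_states: "i \<in> A \<Longrightarrow> (u, v) \<in> acc M i \<Longrightarrow> v \<in> states M"
  using M by (auto simp: structures_def kripke_structures_def)

lemma reach_type_of:
  assumes W: "\<And>u. u \<in> states M \<Longrightarrow> type_of u \<in> set W"
    and f: "f \<in> set (elems \<phi>)" "modal f"
  shows "u \<in> states M \<Longrightarrow> \<not> (everyone_knows M (group f) ^^ k) (sat M (arg f)) u \<Longrightarrow>
     type_of u \<in> set (reach (group f) W (filter (\<lambda>t. \<not> holds t (arg f)) W) k)"
proof (induction k arbitrary: u)
  case 0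
  then show ?case using elems_arg[OF f(2,1)] W by (simp add: holds_type_of)
next
  case (Suc k)
  then obtain i v where iv: "i \<in> group f" "(u, v) \<in> acc M i"
    "\<not> (everyone_knows M (group f) ^^ k) (sat M (arg f)) v"
    unfolding funpow_everyone_knows_Suc by blast
  then have "v \<in> states M" using acc_states grp f(1) by blast
  with Suc.IH iv labels_type_of[OF iv(2,1)] W Suc.prems(1) show ?case
    by (auto simp: hits_def)
qed

lemma fulfilled_type_of:
  assumes W: "\<And>u. u \<in> states M \<Longrightarrow> type_of u \<in> set W" and u: "u \<in> states M"
  shows "fulfilled (elems \<phi>) W (type_of u)"
  unfolding fulfilled_def
proof (intro ballI impI)
  fix f assume f: "f \<in> set (elems \<phi>)" "modal f"
  let ?Y = "filter (\<lambda>t. \<not> holds t (arg f)) W"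
  show "f \<in> set (type_of u) \<or> refuted W (type_of u) f"
  proof (cases "sat M f u")
    case False
    \<comment> \<open>A refuting path has \<open>k + 1\<close> steps; for \<open>Know\<close> and
      \<open>Everyone\<close> it has exactly one.\<close>
    have "\<exists>k. \<not> (everyone_knows M (group f) ^^ Suc k) (sat M (arg f)) u \<and> (\<not> common f \<longrightarrow> k = 0)"
    proof (cases f)
      case (Common G \<psi>)
      then show ?thesis using False unfolding Common sat_Common_Suc by simp
    qed (use False f(2) in \<open>auto simp: everyone_knows_iff knows_def\<close>)
    then obtain k where k: "\<not> (everyone_knows M (group f) ^^ Suc k) (sat M (arg f)) u"
      and k0: "\<not> common f \<Longrightarrow> k = 0" by blast
    obtain i v where iv: "i \<in> group f" "(u, v) \<in> acc M i"
      "\<not> (everyone_knows M (group f) ^^ k) (sat M (arg f)) v"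
      using k unfolding funpow_everyone_knows_Suc by blast
    then have v: "v \<in> states M" using acc_states grp f(1) by blast
    have "type_of v \<in> set (reach (group f) W ?Y k)"
      by (rule reach_type_of[OF W f v iv(3)])
    \<comment> \<open>Paths in \<open>M\<close> may be arbitrarily long; between states in
      \<open>W\<close>, \<open>length W\<close> steps suffice.\<close>
    then have "type_of v \<in> set (reach (group f) W ?Y (if common f then length W else 0))"
      using reach_length[of ?Y W "group f" k] k0 by (auto split: if_splits)
    with labels_type_of[OF iv(2,1)] show ?thesis
      unfolding refuted_def hits_def by blast
  qed (use f in \<open>simp add: type_of_def\<close>)
qed

text \<open>As long as \<open>W\<close> contains all types realized in \<open>M\<close>, each of
  them is fulfilled in \<open>W\<close>, so the next round deletes none of them.\<close>

lemma type_of_eliminate: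
  "(\<And>u. u \<in> states M \<Longrightarrow> type_of u \<in> set W) \<Longrightarrow> u \<in> states M \<Longrightarrow>
     type_of u \<in> set (eliminate k (elems \<phi>) W)"
proof (induction k arbitrary: W)
  case (Suc k)
  show ?case
    unfolding eliminate.simps
    by (rule Suc.IH) (use Suc.prems fulfilled_type_of[OF Suc.prems(1)] in auto)
qed simp

lemma survivor_type_of:
  assumes "u \<in> states M"
  shows "type_of u \<in> set (survivors R \<phi>)"
proof -
  have "type_of v \<in> set (candidates R (elems \<phi>))" if "v \<in> states M" for v
  proof -
    have "(v, v) \<in> acc M i" if "i \<in> R" for i
      using M that \<open>v \<in> states M\<close> by (auto simp: structures_def refl_on_def)
    then have "R \<subseteq> labels R (type_of v) (type_of v)" using labels_type_of by blast
    with labels_subset show ?thesis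
      by (fastforce simp: candidates_def type_of_def filter_in_sublists)
  qed
  with assms show ?thesis unfolding survivors_def Let_def by (blast intro: type_of_eliminate)
qed

lemma survivor_holds:
  assumes "u \<in> states M" "sat M \<phi> u"
  shows "\<exists>s\<in>set (survivors R \<phi>). holds s \<phi>"
  using survivor_type_of[OF assms(1)] holds_type_of[of \<phi> u] assms(2) by auto

end

section \<open>The canonical structure: given states with all permitted transitions\<close>

definition canonical :: "('p, 'a) fm list list \<Rightarrow> (('p, 'a) fm list, 'p, 'a) kripke" where
  "canonical W = \<lparr>states = set W, truth_at = (\<lambda>s p. Prop p \<in> set s),
     acc = (\<lambda>i. {(s, t). s \<in> set W \<and> t \<in> set W \<and> i \<in> labels {i} s t})\<rparr>"

lemma hits_canonical:
  assumes "s \<in> set W" "set Y \<subseteq> set W"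
  shows "hits c s Y \<longleftrightarrow> (\<exists>i\<in>c. \<exists>t\<in>set Y. (s, t) \<in> acc (canonical W) i)"
  using assms by (auto simp: hits_def canonical_def in_labels_iff ex_in_conv[symmetric] simp del: ex_in_conv) 

lemma reach_canonical:
  assumes Y: "\<And>s. s \<in> set Y \<Longrightarrow> s \<in> set W \<and> \<not> X s"
  shows "s \<in> set (reach c W Y k) \<Longrightarrow> \<exists>j\<le>k. \<not> (everyone_knows (canonical W) c ^^ j) X s"
proof (induction k arbitrary: s)
  case 0
  then show ?case using Y by auto
next
  case (Suc k)
  from Suc.prems consider "s \<in> set Y" | "s \<in> set W" "hits c s (reach c W Y k)" by auto
  then show ?case
  proof cases
    case 1
    then show ?thesis using Y by (intro exI[of _ 0]) auto
  next
    case 2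
    then obtain i t where it: "i \<in> c" "t \<in> set (reach c W Y k)" "(s, t) \<in> acc (canonical W) i"
      using hits_canonical[of s W "reach c W Y k" c] reach_subset[of Y W] Y by blast
    then obtain j where "j \<le> k" "\<not> (everyone_knows (canonical W) c ^^ j) X t"
      using Suc.IH by blast
    with it have "\<not> (everyone_knows (canonical W) c ^^ Suc j) X s"
      unfolding funpow_everyone_knows_Suc by blast
    with \<open>j \<le> k\<close> show ?thesis by (metis Suc_le_mono)
  qed
qed

lemma canonical_step:
  "(s, t) \<in> acc (canonical W) i \<Longrightarrow> f \<in> set s \<Longrightarrow> modal f \<Longrightarrow> i \<in> group f \<Longrightarrow>
     t \<in> set W \<and> holds t (obligation f)"
  by (auto simp: canonical_def in_labels_iff)

text \<open>The obligation of \<open>f\<close> is the conjunction of \<open>\<psi>\<close> and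
  \<open>f\<close>, so \<open>f\<close> itself is passed on along every path and yields
  \<open>\<psi>\<close> after each step.\<close>

lemma canonical_Common:
  assumes f: "f = Common G \<psi>" and \<psi>: "\<And>t. t \<in> set W \<Longrightarrow> holds t \<psi> \<Longrightarrow> X t"
  shows "f \<in> set s \<Longrightarrow> (everyone_knows (canonical W) G ^^ Suc k) X s"
proof (induction k arbitrary: s)
  case 0
  then show ?case
    using f canonical_step[of s _ W _ f] \<psi>
    by (auto simp: everyone_knows_def knows_def obligation_def)
next
  case (Suc k)
  have "(everyone_knows (canonical W) G ^^ Suc k) X t"
    if "(s, t) \<in> acc (canonical W) i" "i \<in> G" for i t
    using Suc.IH[of t] canonical_step[OF that(1) Suc.prems] f that(2)
    by (auto simp: obligation_def simp del: funpow.simps)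
  then show ?case unfolding funpow_everyone_knows_Suc[where k = "Suc k"] by blast
qed

text \<open>Modal formulas in \<open>s\<close> are true because permitted transitions respect their
  obligations. The others are false because \<open>fulfilled\<close> supplies a refuting path, and
  this is a path of the canonical structure.\<close>

lemma sat_canonical:
  assumes W: "\<And>s. s \<in> set W \<Longrightarrow> fulfilled L W s"
  shows "set (elems \<psi>) \<subseteq> set L \<Longrightarrow> s \<in> set W \<Longrightarrow> sat (canonical W) \<psi> s \<longleftrightarrow> holds s \<psi>"
proof (induction \<psi> arbitrary: s)
  case (Prop p)
  then show ?case by (simp add: canonical_def)
next
  case (Know i \<psi>)
  let ?f = "Know i \<psi>"
  show ?case
  proof (cases "?f \<in> set s")
    case True
    then have "sat (canonical W) \<psi> t" if "(s, t) \<in> acc (canonical W) i" for t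
      using canonical_step[OF that True] Know that by (auto simp: obligation_def)
    with True show ?thesis by (simp add: knows_def)
  next
    case False
    then have "refuted W s ?f" using W[OF Know.prems(2)] Know.prems by (auto simp: fulfilled_def)
    then obtain t where "t \<in> set W" "\<not> holds t \<psi>" "(s, t) \<in> acc (canonical W) i"
      using hits_canonical[OF Know.prems(2)] by (fastforce simp: refuted_def)
    with Know False show ?thesis by (auto simp: knows_def)
  qed
next
  case (Everyone G \<psi>)
  let ?f = "Everyone G \<psi>"
  show ?case
  proof (cases "?f \<in> set s")
    case True
    then have "sat (canonical W) \<psi> t" if "i \<in> G" "(s, t) \<in> acc (canonical W) i" for i t
      using canonical_step[OF that(2) True] Everyone that by (auto simp: obligation_def)
    with True show ?thesis by (simp add: everyone_knows_def knows_def)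
  next
    case False
    then have "refuted W s ?f"
      using W[OF Everyone.prems(2)] Everyone.prems by (auto simp: fulfilled_def)
    then obtain i t where "i \<in> G" "t \<in> set W" "\<not> holds t \<psi>" "(s, t) \<in> acc (canonical W) i"
      using hits_canonical[OF Everyone.prems(2)] by (fastforce simp: refuted_def)
    with Everyone False show ?thesis by (auto simp: everyone_knows_def knows_def)
  qed
next
  case (Common G \<psi>)
  let ?f = "Common G \<psi>" and ?Y = "filter (\<lambda>t. \<not> holds t \<psi>) W"
  have IH: "sat (canonical W) \<psi> t \<longleftrightarrow> holds t \<psi>" if "t \<in> set W" for t
    using Common that by auto
  show ?case
  proof (cases "?f \<in> set s")
    case True
    then have "(everyone_knows (canonical W) G ^^ Suc k) (sat (canonical W) \<psi>) s" for k
      using canonical_Common[OF refl] IH by blast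
    then show ?thesis using True unfolding sat_Common_Suc by simp
  next
    case False
    then have "refuted W s ?f"
      using W[OF Common.prems(2)] Common.prems by (auto simp: fulfilled_def)
    then obtain i t where it: "i \<in> G" "(s, t) \<in> acc (canonical W) i"
        "t \<in> set (reach G W ?Y (length W))"
      using hits_canonical[OF Common.prems(2) reach_subset[of ?Y W]] by (auto simp: refuted_def)
    then obtain j where "\<not> (everyone_knows (canonical W) G ^^ j) (sat (canonical W) \<psi>) t"
      using reach_canonical[OF _ it(3), of "sat (canonical W) \<psi>"] IH by auto
    with it have "\<not> (everyone_knows (canonical W) G ^^ Suc j) (sat (canonical W) \<psi>) s"
      unfolding funpow_everyone_knows_Suc by blast
    with False show ?thesis unfolding sat_Common_Suc by auto
  qed
qed auto

lemma holds_survivor: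
  assumes "s \<in> set (survivors R \<phi>)" "holds s \<phi>"
  shows "satisfiable_in (structures A R :: (('p, 'a) fm list, 'p, 'a) kripke set) \<phi>"
proof -
  define W where "W = survivors R \<phi>"
  have ful: "fulfilled (elems \<phi>) W s" if "s \<in> set W" for s
    using that unfolding W_def survivors_def Let_def by (intro eliminate_stable) auto
  \<comment> \<open>Elimination only deletes states, so the survivors all passed the initial test,
    which gives each agent in \<open>R\<close> a loop there.\<close>
  have "labels R s s = R" if "s \<in> set W" for s
    using that eliminate_subset unfolding W_def survivors_def candidates_def Let_def by fastforce
  then have "canonical W \<in> structures A R"
    by (fastforce simp: structures_def kripke_structures_def canonical_def refl_on_def in_labels_iff)
  moreover have "s \<in> states (canonical W)" "sat (canonical W) \<phi> s"
    using assms sat_canonical[OF ful] by (auto simp: canonical_def W_def)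
  ultimately show ?thesis unfolding satisfiable_in_def by blast
qed

theorem survivors_correct:
  fixes \<phi> :: "('p, 'a :: countable) fm"
  assumes inf: "infinite (UNIV :: 's set)" and \<phi>: "\<phi> \<in> lang \<Phi> A \<G>"
    and \<G>: "\<And>G. G \<in> \<G> \<Longrightarrow> G \<subseteq> A" and R: "R = {} \<or> R = A"
  shows "satisfiable_in (structures A R :: ('s, 'p, 'a) kripke set) \<phi> \<longleftrightarrow>
     (\<exists>s\<in>set (survivors R \<phi>). holds s \<phi>)"
proof
  assume "satisfiable_in (structures A R :: ('s, 'p, 'a) kripke set) \<phi>"
  then obtain M :: "('s, 'p, 'a) kripke" and u
    where M: "M \<in> structures A R" and u: "u \<in> states M" "sat M \<phi> u"
    by (auto simp: satisfiable_in_def)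
  have "group f \<subseteq> A" if "f \<in> set (elems \<phi>)" for f
    using group_lang[OF elems_lang[OF \<phi> that] \<G>] .
  then show "\<exists>s\<in>set (survivors R \<phi>). holds s \<phi>" by (rule survivor_holds[OF M _ u])
next
  assume "\<exists>s\<in>set (survivors R \<phi>). holds s \<phi>"
  then have "satisfiable_in (structures A R :: (('p, 'a) fm list, 'p, 'a) kripke set) \<phi>"
    using holds_survivor by blast
  \<comment> \<open>The canonical structure has lists as states. For \<open>R = {}\<close> and
    \<open>R = A\<close> it can be exchanged for one with states of type \<open>'s\<close>.\<close>
  then show "satisfiable_in (structures A R :: ('s, 'p, 'a) kripke set) \<phi>"
    using R satisfiable_in_transfer[OF inf \<G> \<phi>]
    by (auto simp: structures_empty structures_full)
qed

section \<open>Programs\<close>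

definition wp :: "prog \<Rightarrow> data list \<Rightarrow> expr \<Rightarrow> (data \<Rightarrow> nat \<Rightarrow> bool) \<Rightarrow> bool" where
  "wp P env e Q \<longleftrightarrow> (\<exists>v n. eval P env e v n \<and> Q v n)"

definition wps :: "prog \<Rightarrow> data list \<Rightarrow> expr list \<Rightarrow> (data list \<Rightarrow> nat \<Rightarrow> bool) \<Rightarrow> bool" where
  "wps P env es Q \<longleftrightarrow> (\<exists>vs n. evals P env es vs n \<and> Q vs n)"

inductive_simps eval_iffs:
  "eval P env (Var x) v n" "eval P env (Lit m) v n" "eval P env (Prim p es) v n"
  "eval P env (Cond b e1 e2) v n" "eval P env (Bind e1 e2) v n" "eval P env (Call f es) v n"
  "evals P env [] vs n" "evals P env (e # es) vs n"

lemma wp_simps [simp]: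
  "wp P env (Var x) Q \<longleftrightarrow> x < length env \<and> Q (env ! x) 1"
  "wp P env (Lit m) Q \<longleftrightarrow> Q (Num m) 1"
  "wp P env (Prim p es) Q \<longleftrightarrow>
     wps P env es (\<lambda>vs n. case apply_prim p vs of None \<Rightarrow> False | Some v \<Rightarrow> Q v (1 + n))"
  "wp P env (Cond b e1 e2) Q \<longleftrightarrow>
     wp P env b (\<lambda>u m. if u = Num 0 then wp P env e2 (\<lambda>v n. Q v (1 + m + n))
                       else wp P env e1 (\<lambda>v n. Q v (1 + m + n)))"
  "wp P env (Bind e1 e2) Q \<longleftrightarrow>
     wp P env e1 (\<lambda>u m. wp P (u # env) e2 (\<lambda>v n. Q v (1 + m + n)))"
  "wp P env (Call f es) Q \<longleftrightarrow>
     wps P env es (\<lambda>vs m. f < length P \<and> wp P vs (P ! f) (\<lambda>v n. Q v (1 + m + n)))"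
  "wps P env [] R \<longleftrightarrow> R [] 0"
  "wps P env (e # es) R \<longleftrightarrow> wp P env e (\<lambda>v m. wps P env es (\<lambda>vs n. R (v # vs) (m + n)))"
  unfolding wp_def wps_def eval_iffs by (auto split: option.splits if_splits; fastforce)+

text \<open>By determinism the exact number of steps is a function of the call. It serves as an
  opaque term during symbolic execution and is bounded only afterwards.\<close>

definition run_time :: "prog \<Rightarrow> nat \<Rightarrow> data list \<Rightarrow> nat" where
  "run_time P f vs = (THE n. \<exists>v. eval P vs (P ! f) v n)"

definition computes :: "prog \<Rightarrow> nat \<Rightarrow> data list \<Rightarrow> data \<Rightarrow> nat \<Rightarrow> bool" where
  "computes P f vs r T \<longleftrightarrow> wp P vs (P ! f) (\<lambda>v n. v = r \<and> n \<le> T)"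

text \<open>The first part is an equation, so that a call can be rewritten away under any
  postcondition; the second leaves the bound on the steps to linear arithmetic.\<close>

lemma computesD:
  assumes "computes P f vs r T"
  shows "wp P vs (P ! f) Q \<longleftrightarrow> Q r (run_time P f vs)" and "run_time P f vs \<le> T"
proof -
  obtain n where n: "eval P vs (P ! f) r n" "n \<le> T"
    using assms by (auto simp: computes_def wp_def)
  then have "run_time P f vs = n"
    unfolding run_time_def by (intro the_equality) (auto dest: eval_deterministic(1))
  with n show "run_time P f vs \<le> T" "wp P vs (P ! f) Q \<longleftrightarrow> Q r (run_time P f vs)"
    by (auto simp: wp_def dest: eval_deterministic(1))
qed

lemma computes_mono: "computes P f vs r T \<Longrightarrow> T \<le> T' \<Longrightarrow> computes P f vs r T'"
  unfolding computes_def wp_def by (meson order_trans)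

text \<open>Raising \<open>t\<close> by one adds at most one element, so the count takes every value
  up to \<open>card X\<close>.\<close>

lemma threshold:
  fixes X :: "nat set"
  assumes "finite X" "m \<le> card X"
  shows "\<exists>t. card {x \<in> X. x < t} = m"
proof -
  let ?g = "\<lambda>t. card {x \<in> X. x < t}"
  obtain b where b: "\<forall>x\<in>X. x < b" using assms(1) finite_nat_set_iff_bounded by auto
  then have "?g b = card X" by (metis (mono_tags, lifting) Collect_cong Collect_mem_eq)
  moreover have "?g (Suc t) \<le> Suc (?g t)" for t
  proof -
    have "{x \<in> X. x < Suc t} \<subseteq> insert t {x \<in> X. x < t}" by auto
    then have "?g (Suc t) \<le> card (insert t {x \<in> X. x < t})"
      using assms(1) by (intro card_mono) auto
    also have "\<dots> \<le> Suc (?g t)" using assms(1) by (simp add: card_insert_if)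
    finally show ?thesis .
  qed
  then have "\<exists>t. ?g t = m" if "m \<le> ?g b" for b
    using that
  proof (induction b)
    case (Suc b)
    then show ?case
    proof (cases "m \<le> ?g b")
      case False
      moreover have "?g (Suc b) \<le> Suc (?g b)" by (rule Suc.prems(1))
      ultimately have "?g (Suc b) = m" using Suc.prems(2) by linarith
      then show ?thesis ..
    qed blast
  qed auto
  ultimately show ?thesis using assms(2) by metis
qed

text \<open>Binary search for the value of a variable, with the numbers in \<open>X\<close> wired into the program.\<close>

lemma decision_tree:
  fixes e :: "nat \<Rightarrow> expr"
  assumes "finite X" "card X \<le> 2 ^ k"
  shows "\<exists>b. \<forall>x\<in>X. \<forall>P env v n. j < length env \<longrightarrow> env ! j = Num x \<longrightarrow>
     eval P env (e x) v n \<longrightarrow> (\<exists>m \<le> n + 4 * k. eval P env b v m)"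
proof -
  define T where "T X k b \<longleftrightarrow> (\<forall>x\<in>X. \<forall>P env v n. j < length env \<longrightarrow> env ! j = Num x \<longrightarrow>
     eval P env (e x) v n \<longrightarrow> (\<exists>m \<le> n + 4 * k. eval P env b v m))" for X k b
  have "\<exists>b. T X k b" using assms
  proof (induction k arbitrary: X)
    case 0
    then consider "X = {}" | y where "X = {y}" by (auto simp: le_Suc_eq card_1_singleton_iff)
    then show ?case
    proof cases
      case 2
      then show ?thesis unfolding T_def by (intro exI[of _ "e y"]) auto
    qed (auto simp: T_def)
  next
    case (Suc k)
    \<comment> \<open>The lower part gets \<open>2 ^ k\<close> elements if there are that many, so
      the upper part has at most \<open>2 ^ k\<close> as well.\<close>
    define m where "m = min (card X) (2 ^ k)"
    have "m \<le> card X" by (simp add: m_def)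
    then obtain t where t: "card {x \<in> X. x < t} = m" using threshold[OF Suc.prems(1)] by blast
    let ?Y = "{x \<in> X. x < t}" and ?Z = "{x \<in> X. \<not> x < t}"
    have fin: "finite ?Y" "finite ?Z" using Suc.prems(1) by auto
    then have "card X = card ?Y + card ?Z"
      by (subst card_Un_disjoint[symmetric]) (auto intro: arg_cong[where f = card])
    then have c: "card ?Y \<le> 2 ^ k" "card ?Z \<le> 2 ^ k" using Suc.prems(2) t by (auto simp: m_def)
    obtain b where b: "T ?Y k b" using Suc.IH[OF fin(1) c(1)] ..
    obtain b' where b': "T ?Z k b'" using Suc.IH[OF fin(2) c(2)] ..
    \<comment> \<open>A level costs four steps: the conditional, the comparison and its two
      operands.\<close>
    have "\<exists>m \<le> n + 4 * Suc k. eval P env (Cond (Prim LESS [Var j, Lit t]) b b') v m"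
      if x: "x \<in> X" "j < length env" "env ! j = Num x" "eval P env (e x) v n" for x P env v n
    proof -
      have "eval P env (Var j) (Num x) 1" using eval_evals.Var[OF x(2)] x(3) by simp
      then have "evals P env [Var j, Lit t] [Num x, Num t] (1 + (1 + 0))"
        by (intro eval_evals.intros)
      then have test: "eval P env (Prim LESS [Var j, Lit t]) (Num (if x < t then 1 else 0)) (1 + (1 + (1 + 0)))"
        by (rule eval_evals.Prim) simp
      show ?thesis
      proof (cases "x < t")
        case True
        then obtain m where m: "m \<le> n + 4 * k" "eval P env b v m"
          using b x unfolding T_def by blast
        have "eval P env (Cond (Prim LESS [Var j, Lit t]) b b') v (1 + (1 + (1 + (1 + 0))) + m)"
          by (rule eval_evals.CondT[OF test _ m(2)]) (use True in simp)
        with m(1) show ?thesis by (intro exI conjI) auto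
      next
        case False
        then obtain m where m: "m \<le> n + 4 * k" "eval P env b' v m"
          using b' x unfolding T_def by blast
        have "eval P env (Cond (Prim LESS [Var j, Lit t]) b b') v (1 + (1 + (1 + (1 + 0))) + m)"
          by (rule eval_evals.CondF[OF _ m(2)]) (use False test in simp)
        with m(1) show ?thesis by (intro exI conjI) auto
      qed
    qed
    then have "T X (Suc k) (Cond (Prim LESS [Var j, Lit t]) b b')" unfolding T_def by blast
    then show ?case ..
  qed
  then show ?thesis unfolding T_def .
qed

section \<open>Data encodings and the program\<close>

abbreviation truth :: "bool \<Rightarrow> data" where
  "truth b \<equiv> Num (if b then 1 else 0)"

primrec encode_list :: "data list \<Rightarrow> data" where
  "encode_list [] = Num 0"
| "encode_list (x # xs) = Cell x (encode_list xs)"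

primrec nodes :: "data \<Rightarrow> nat" where
  "nodes (Num n) = 1"
| "nodes (Cell x y) = 1 + nodes x + nodes y"

abbreviation "Head e \<equiv> Prim FST [e]"
abbreviation "Tail e \<equiv> Prim SND [e]"
abbreviation "Atomic e \<equiv> Prim IS_NUM [e]"
abbreviation "Join e e' \<equiv> Prim CONS [e, e']"
abbreviation "Tagged e k \<equiv> Prim EQ [Head e, Lit k]"

abbreviation (input) "f_refuters \<equiv> Suc 0"
abbreviation (input) "f_equal \<equiv> 2 :: nat"
abbreviation (input) "f_member \<equiv> 3 :: nat"
abbreviation (input) "f_holds \<equiv> 4 :: nat"
abbreviation (input) "f_labels \<equiv> 5 :: nat"
abbreviation (input) "f_hits \<equiv> 6 :: nat"
abbreviation (input) "f_hitters \<equiv> 7 :: nat"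
abbreviation (input) "f_reach \<equiv> 8 :: nat"
abbreviation (input) "f_fulfilled \<equiv> 9 :: nat"
abbreviation (input) "f_round \<equiv> 10 :: nat"
abbreviation (input) "f_eliminate \<equiv> 11 :: nat"
abbreviation (input) "f_candidates \<equiv> 12 :: nat"
abbreviation (input) "f_extend \<equiv> 13 :: nat"
abbreviation (input) "f_sublists \<equiv> 14 :: nat"
abbreviation (input) "f_elems \<equiv> 15 :: nat"
abbreviation (input) "f_group \<equiv> 16 :: nat"
abbreviation (input) "f_diff \<equiv> 17 :: nat"

text \<open>Here \<open>r\<close> is meant as the code of \<open>R\<close>, and \<open>grp\<close>
  and \<open>dif\<close> as the lookup tables. The main function builds the code of
  \<open>Neg \<phi>\<close>, since the survivors refuting that formula are those at which
  \<open>\<phi>\<close> holds.\<close>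

definition program :: "nat \<Rightarrow> expr \<Rightarrow> expr \<Rightarrow> prog" where
  "program r grp dif = [
  \<comment> \<open>main: \<open>\<phi>\<close>\<close>
  Bind (Call f_elems [Var 0, Lit 0])
    (Bind (Call f_candidates [Call f_sublists [Var 0]])
      (Cond (Atomic (Call f_refuters [Join (Lit 1) (Var 2), Call f_eliminate [Var 0, Var 1, Var 0]]))
        (Lit 0) (Lit 1))),
  \<comment> \<open>the states in \<open>W\<close> where \<open>f\<close> does not hold: \<open>f, W\<close>\<close>
  Cond (Atomic (Var 1)) (Lit 0)
    (Cond (Call f_holds [Head (Var 1), Var 0])
      (Call f_refuters [Var 0, Tail (Var 1)])
      (Join (Head (Var 1)) (Call f_refuters [Var 0, Tail (Var 1)]))),
  \<comment> \<open>equal: \<open>x, y\<close>\<close>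
  Cond (Atomic (Var 0))
    (Cond (Atomic (Var 1)) (Prim EQ [Var 0, Var 1]) (Lit 0))
    (Cond (Atomic (Var 1)) (Lit 0)
      (Cond (Call f_equal [Head (Var 0), Head (Var 1)])
        (Call f_equal [Tail (Var 0), Tail (Var 1)]) (Lit 0))),
  \<comment> \<open>member: \<open>x, xs\<close>\<close>
  Cond (Atomic (Var 1)) (Lit 0)
    (Cond (Call f_equal [Var 0, Head (Var 1)]) (Lit 1) (Call f_member [Var 0, Tail (Var 1)])),
  \<comment> \<open>holds: \<open>s, f\<close>\<close>
  Cond (Tagged (Var 1) 1)
    (Cond (Call f_holds [Var 0, Tail (Var 1)]) (Lit 0) (Lit 1))
    (Cond (Tagged (Var 1) 2)
      (Cond (Call f_holds [Var 0, Head (Tail (Var 1))])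
        (Call f_holds [Var 0, Tail (Tail (Var 1))]) (Lit 0))
      (Call f_member [Var 1, Var 0])),
  \<comment> \<open>labels: \<open>c, s, t\<close>\<close>
  Cond (Atomic (Var 1)) (Var 0)
    (Bind (Head (Var 1))
      (Cond (Tagged (Var 0) 0)
        (Call f_labels [Var 1, Tail (Var 2), Var 3])
        (Cond
          (Call f_holds
            [Var 3,
             Cond (Tagged (Var 0) 5) (Join (Lit 2) (Join (Tail (Tail (Var 0))) (Var 0)))
               (Tail (Tail (Var 0)))])
          (Call f_labels [Var 1, Tail (Var 2), Var 3])
          (Call f_labels [Call f_diff [Var 1, Call f_group [Var 0]], Tail (Var 2), Var 3])))),
  \<comment> \<open>hits: \<open>c, s, Y\<close>\<close>
  Cond (Atomic (Var 2)) (Lit 0)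
    (Cond (Call f_labels [Var 0, Var 1, Head (Var 2)]) (Lit 1)
      (Call f_hits [Var 0, Var 1, Tail (Var 2)])),
  \<comment> \<open>the states in \<open>W\<close> that hit \<open>Y\<close>, followed by \<open>Z\<close>: \<open>c, W, Y, Z\<close>\<close>
  Cond (Atomic (Var 1)) (Var 3)
    (Cond (Call f_hits [Var 0, Head (Var 1), Var 2])
      (Join (Head (Var 1)) (Call f_hitters [Var 0, Tail (Var 1), Var 2, Var 3]))
      (Call f_hitters [Var 0, Tail (Var 1), Var 2, Var 3])),
  \<comment> \<open>reach: \<open>c, W, Y\<close>, and a list that serves as a counter\<close>
  Cond (Atomic (Var 3)) (Var 2)
    (Call f_hitters
      [Var 0, Var 1, Call f_reach [Var 0, Var 1, Var 2, Tail (Var 3)], Var 2]),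
  \<comment> \<open>fulfilled: \<open>L, W, s\<close>\<close>
  Cond (Atomic (Var 0)) (Lit 1)
    (Bind (Head (Var 0))
      (Cond
        (Cond (Tagged (Var 0) 0) (Lit 1)
          (Cond (Call f_member [Var 0, Var 3]) (Lit 1)
            (Call f_hits
              [Call f_group [Var 0], Var 3,
               Call f_reach
                 [Call f_group [Var 0], Var 2, Call f_refuters [Tail (Tail (Var 0)), Var 2],
                  Cond (Tagged (Var 0) 5) (Var 2) (Lit 0)]])))
        (Call f_fulfilled [Tail (Var 1), Var 2, Var 3])
        (Lit 0))),
  \<comment> \<open>the states in \<open>X\<close> that are fulfilled in \<open>W\<close>: \<open>L, W, X\<close>\<close>
  Cond (Atomic (Var 2)) (Lit 0)
    (Cond (Call f_fulfilled [Var 0, Var 1, Head (Var 2)])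
      (Join (Head (Var 2)) (Call f_round [Var 0, Var 1, Tail (Var 2)]))
      (Call f_round [Var 0, Var 1, Tail (Var 2)])),
  \<comment> \<open>eliminate: a list that serves as a counter, and \<open>L, W\<close>\<close>
  Cond (Atomic (Var 0)) (Var 2)
    (Call f_eliminate [Tail (Var 0), Var 1, Call f_round [Var 1, Var 2, Var 2]]),
  \<comment> \<open>candidates: a list of states\<close>
  Cond (Atomic (Var 0)) (Lit 0)
    (Cond (Prim EQ [Call f_labels [Lit r, Head (Var 0), Head (Var 0)], Lit r])
      (Join (Head (Var 0)) (Call f_candidates [Tail (Var 0)]))
      (Call f_candidates [Tail (Var 0)])),
  \<comment> \<open>\<open>map ((#) x) xs @ ys\<close>: \<open>x, xs, ys\<close>\<close>
  Cond (Atomic (Var 1)) (Var 2)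
    (Join (Join (Var 0) (Head (Var 1))) (Call f_extend [Var 0, Tail (Var 1), Var 2])),
  \<comment> \<open>sublists: \<open>xs\<close>\<close>
  Cond (Atomic (Var 0)) (Join (Lit 0) (Lit 0))
    (Bind (Call f_sublists [Tail (Var 0)])
      (Call f_extend [Head (Var 1), Var 0, Var 0])),
  \<comment> \<open>\<open>elems f @ xs\<close>: \<open>f, xs\<close>\<close>
  Cond (Tagged (Var 0) 0) (Join (Var 0) (Var 1))
    (Cond (Tagged (Var 0) 1) (Call f_elems [Tail (Var 0), Var 1])
      (Cond (Tagged (Var 0) 2)
        (Call f_elems [Head (Tail (Var 0)), Call f_elems [Tail (Tail (Var 0)), Var 1]])
        (Join (Var 0) (Call f_elems [Tail (Tail (Var 0)), Var 1])))),
  grp,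
  dif]"

lemma length_program [simp]: "length (program r grp dif) = 18"
  by (simp add: program_def)

lemmas main_code = program_def[THEN arg_cong[where f = "\<lambda>P. P ! 0"], simplified]
lemmas refuters_code = program_def[THEN arg_cong[where f = "\<lambda>P. P ! Suc 0"], simplified]
lemmas equal_code = program_def[THEN arg_cong[where f = "\<lambda>P. P ! 2"], simplified]
lemmas member_code = program_def[THEN arg_cong[where f = "\<lambda>P. P ! 3"], simplified]
lemmas holds_code = program_def[THEN arg_cong[where f = "\<lambda>P. P ! 4"], simplified]
lemmas labels_code = program_def[THEN arg_cong[where f = "\<lambda>P. P ! 5"], simplified]
lemmas hits_code = program_def[THEN arg_cong[where f = "\<lambda>P. P ! 6"], simplified]
lemmas hitters_code = program_def[THEN arg_cong[where f = "\<lambda>P. P ! 7"], simplified]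
lemmas reach_code = program_def[THEN arg_cong[where f = "\<lambda>P. P ! 8"], simplified]
lemmas fulfilled_code = program_def[THEN arg_cong[where f = "\<lambda>P. P ! 9"], simplified]
lemmas round_code = program_def[THEN arg_cong[where f = "\<lambda>P. P ! 10"], simplified]
lemmas eliminate_code = program_def[THEN arg_cong[where f = "\<lambda>P. P ! 11"], simplified]
lemmas candidates_code = program_def[THEN arg_cong[where f = "\<lambda>P. P ! 12"], simplified]
lemmas extend_code = program_def[THEN arg_cong[where f = "\<lambda>P. P ! 13"], simplified]
lemmas sublists_code = program_def[THEN arg_cong[where f = "\<lambda>P. P ! 14"], simplified]
lemmas elems_code = program_def[THEN arg_cong[where f = "\<lambda>P. P ! 15"], simplified]
lemmas group_code = program_def[THEN arg_cong[where f = "\<lambda>P. P ! 16"], simplified]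
lemmas diff_code = program_def[THEN arg_cong[where f = "\<lambda>P. P ! 17"], simplified]

section \<open>Correctness and running time of the program\<close>

lemma nodes_encode_fm: "nodes (encode_fm name f) \<le> 4 * fm_length f"
  by (induction f) auto

text \<open>Tags separate the constructors and \<open>name\<close> separates the groups in
  \<open>\<G>\<close>; hence comparing codes decides equality of formulas.\<close>

lemma inj_on_encode_fm:
  assumes "inj_on name \<G>" "f \<in> lang \<Phi> A \<G>" "g \<in> lang \<Phi> A \<G>"
  shows "encode_fm name f = encode_fm name g \<longleftrightarrow> f = g"
proof
  assume "encode_fm name f = encode_fm name g"
  with assms(2,3) show "f = g"
  proof (induction arbitrary: g rule: lang.induct)
    case (5 G f)
    from 5(4,5) assms(1) show ?case by cases (use 5 in \<open>auto dest: inj_onD\<close>)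
  next
    case (6 G f)
    from 6(4,5) assms(1) show ?case by cases (use 6 in \<open>auto dest: inj_onD\<close>)
  next
    case (1 p)
    from 1(2,3) show ?case by cases auto
  next
    case (2 f)
    from 2(3,4) show ?case by cases (use 2 in auto)
  next
    case (3 f f')
    from 3(5,6) show ?case by cases (use 3 in auto)
  next
    case (4 i f)
    from 4(4,5) show ?case by cases (use 4 in auto)
  qed
qed simp

lemma elems_literal: "f \<in> set (elems \<phi>) \<Longrightarrow> modal f \<or> (\<exists>p. f = Prop p)"
  by (induction \<phi>) auto

lemma fm_length_elems: "f \<in> set (elems \<phi>) \<Longrightarrow> fm_length f \<le> fm_length \<phi>"
  by (induction \<phi>) auto

lemma length_elems: "length (elems \<phi>) \<le> fm_length \<phi>"
  by (induction \<phi>) auto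

lemma fm_length_obligation: "modal f \<Longrightarrow> fm_length (obligation f) \<le> 2 * fm_length f"
  by (cases f) (auto simp: obligation_def)

lemma lang_arg: "f \<in> lang \<Phi> A \<G> \<Longrightarrow> modal f \<Longrightarrow> arg f \<in> lang \<Phi> A \<G>"
  by (cases rule: lang.cases) auto

lemma lang_obligation: "f \<in> lang \<Phi> A \<G> \<Longrightarrow> modal f \<Longrightarrow> obligation f \<in> lang \<Phi> A \<G>"
  by (auto simp: obligation_def intro: lang.intros lang_arg)

lemma reach_length_le: "length (reach c W Y k) \<le> length W + length Y"
  by (cases k) (auto simp: length_filter_le)

text \<open>\<open>K\<close> bounds each of the two table lookups, and \<open>B\<close> is the base
  of the other bounds. \<open>B\<close> depends on the input \<open>\<phi>\<close>, whereas
  \<open>P\<close> is built from \<open>R\<close>, \<open>grp\<close> and \<open>dif\<close>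
  alone.\<close>

locale decider =
  fixes \<Phi> A :: "nat set" and \<G> :: "nat set set" and name :: "nat set \<Rightarrow> nat"
    and \<phi> :: "(nat, nat) fm" and R :: "nat set" and grp dif :: expr and K B :: nat and P :: prog
  assumes finA: "finite A" and \<G>: "\<And>G. G \<in> \<G> \<Longrightarrow> G \<subseteq> A" and inj: "inj_on name \<G>"
    and R: "R \<subseteq> A" and \<phi>: "\<phi> \<in> lang \<Phi> A \<G>"
    and P: "P = program (set_encode R) grp dif"
    and group_spec: "\<And>f. f \<in> lang \<Phi> A \<G> \<Longrightarrow> modal f \<Longrightarrow>
      computes P f_group [encode_fm name f] (Num (set_encode (group f))) K"
    and diff_spec: "\<And>c c'. c \<subseteq> A \<Longrightarrow> c' \<subseteq> A \<Longrightarrow>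
      computes P f_diff [Num (set_encode c), Num (set_encode c')] (Num (set_encode (c - c'))) K"
    and K: "1 \<le> K" and B: "B = 64 * 2 ^ fm_length \<phi>"
begin

abbreviation "enc \<equiv> encode_fm name"
abbreviation "encs s \<equiv> encode_list (map enc s)"
abbreviation "encss W \<equiv> encode_list (map encs W)"
abbreviation "code c \<equiv> Num (set_encode c)"
abbreviation "L \<equiv> elems \<phi>"

lemma length_P [simp]: "length P = 18"
  by (simp add: P)

text \<open>Since \<open>B\<close> exceeds all constants, lengths and numbers of states that occur, a composition of
  steps or a loop only increases the exponent.\<close>

definition cost :: "nat \<Rightarrow> nat" where
  "cost a = K * B ^ a"

lemma cost_Suc: "m \<le> B \<Longrightarrow> m * cost a \<le> cost (Suc a)"
  by (simp add: cost_def)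

lemma cost_less: "a < b \<Longrightarrow> 64 * cost a \<le> cost b"
proof (induction b)
  case (Suc b)
  have "64 * cost b \<le> cost (Suc b)" by (rule cost_Suc) (simp add: B)
  with Suc show ?case by (auto simp: less_Suc_eq)
qed simp

lemma cost_pos: "1 \<le> cost a"
proof -
  have "0 < K * B ^ a" using K by (simp add: B)
  then show ?thesis unfolding cost_def by linarith
qed

lemma cost_0: "cost 0 = K"
  by (simp add: cost_def)

lemma fm_length_less: "fm_length \<phi> < 2 ^ fm_length \<phi>"
  by (rule less_exp)

lemma length_lt_B: "length xs \<le> fm_length \<phi> \<Longrightarrow> length xs < B"
  using fm_length_less unfolding B by linarith

lemma lengths_lt_B: "m \<le> 2 * 2 ^ fm_length \<phi> \<Longrightarrow> m < B"
  by (auto simp: B intro: le_less_trans)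

lemma fm_length_le_B: "fm_length f \<le> 2 * fm_length \<phi> \<Longrightarrow> 4 * fm_length f \<le> B"
  using fm_length_less unfolding B by linarith

definition state :: "(nat, nat) fm list \<Rightarrow> bool" where
  "state s \<longleftrightarrow> set s \<subseteq> set L \<and> length s \<le> fm_length \<phi>"

text \<open>Besides members of \<open>L\<close>, the program evaluates obligations and
  \<open>Neg \<phi>\<close>, which may be up to twice as long as \<open>\<phi>\<close>. The factor 4
  accounts for the nodes of the code.\<close>

definition small :: "(nat, nat) fm \<Rightarrow> bool" where
  "small f \<longleftrightarrow> f \<in> lang \<Phi> A \<G> \<and> 4 * fm_length f \<le> B"

lemma L_lang: "f \<in> set L \<Longrightarrow> f \<in> lang \<Phi> A \<G>"
  using elems_lang[OF \<phi>] .

lemma L_small: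
  assumes "f \<in> set L"
  shows "small f" and "modal f \<Longrightarrow> small (obligation f)" and "modal f \<Longrightarrow> small (arg f)"
    and "group f \<subseteq> A"
proof -
  have f: "f \<in> lang \<Phi> A \<G>" "fm_length f \<le> fm_length \<phi>"
    using assms L_lang fm_length_elems by auto
  then show "small f" by (auto simp: small_def intro: fm_length_le_B)
  show "small (obligation f)" if "modal f"
    using that f fm_length_obligation[of f] lang_obligation[of f]
    by (auto simp: small_def intro: fm_length_le_B)
  have "fm_length (arg f) \<le> fm_length f" by (cases f) auto
  then show "small (arg f)" if "modal f"
    using that f lang_arg[of f] by (auto simp: small_def intro: fm_length_le_B)
  show "group f \<subseteq> A" using group_lang[OF f(1) \<G>] .
qed

text \<open>The empty set has code 0, so a code of labels can itself be the test of a conditional.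
  Finiteness of \<open>A\<close> makes the coding injective.\<close>

lemma code_eq_0: "c \<subseteq> A \<Longrightarrow> code c = Num 0 \<longleftrightarrow> c = {}"
  using set_encode_eq[of c "{}"] finA by (auto dest: finite_subset)

lemma code_eq: "c \<subseteq> A \<Longrightarrow> c' \<subseteq> A \<Longrightarrow> set_encode c = set_encode c' \<longleftrightarrow> c = c'"
  using set_encode_eq[of c c'] finA by (auto dest: finite_subset)

section \<open>Basic routines: equality, membership, truth and labels\<close>

lemmas P_main = main_code[of "set_encode R" grp dif, folded P]
lemmas P_refuters = refuters_code[of "set_encode R" grp dif, folded P]
lemmas P_equal = equal_code[of "set_encode R" grp dif, folded P]
lemmas P_member = member_code[of "set_encode R" grp dif, folded P]
lemmas P_holds = holds_code[of "set_encode R" grp dif, folded P]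
lemmas P_labels = labels_code[of "set_encode R" grp dif, folded P]
lemmas P_hits = hits_code[of "set_encode R" grp dif, folded P]
lemmas P_hitters = hitters_code[of "set_encode R" grp dif, folded P]
lemmas P_reach = reach_code[of "set_encode R" grp dif, folded P]
lemmas P_fulfilled = fulfilled_code[of "set_encode R" grp dif, folded P]
lemmas P_round = round_code[of "set_encode R" grp dif, folded P]
lemmas P_eliminate = eliminate_code[of "set_encode R" grp dif, folded P]
lemmas P_candidates = candidates_code[of "set_encode R" grp dif, folded P]
lemmas P_extend = extend_code[of "set_encode R" grp dif, folded P]
lemmas P_sublists = sublists_code[of "set_encode R" grp dif, folded P]
lemmas P_elems = elems_code[of "set_encode R" grp dif, folded P]

text \<open>Both trees are descended together and a mismatch ends the comparison, so the size of
  \<open>x\<close> alone bounds the time.\<close>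

lemma equal_spec: "computes P f_equal [x, y] (truth (x = y)) (30 * nodes x)"
proof (induction x arbitrary: y)
  case (Num n)
  show ?case unfolding computes_def P_equal by (cases y) simp_all
next
  case (Cell a b)
  show ?case
  proof (cases y)
    case (Cell c d)
    note IH = Cell.IH(1)[of c] Cell.IH(2)[of d]
    show ?thesis
      unfolding computes_def P_equal
      using IH[THEN computesD(2)] by (simp add: Cell IH[THEN computesD(1)])
  qed (simp add: computes_def P_equal)
qed

lemma member_spec_le:
  "30 * nodes x + 20 \<le> m \<Longrightarrow>
     computes P f_member [x, encode_list xs] (truth (x \<in> set xs)) ((length xs + 1) * m)"
proof (induction xs)
  case Nil
  then show ?case by (simp add: computes_def P_member)
next
  case (Cons y xs)
  note e = equal_spec[of x y] and IH = Cons.IH[OF Cons.prems]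
  show ?case
    unfolding computes_def P_member
    using Cons.prems computesD(2)[OF e] computesD(2)[OF IH]
    by (simp add: computesD(1)[OF e] computesD(1)[OF IH])
qed

lemma member_spec:
  assumes f: "small f" and s: "state s"
  shows "computes P f_member [enc f, encs s] (truth (f \<in> set s)) (cost 3)"
proof -
  have "30 * nodes (enc f) + 20 \<le> cost 2"
  proof -
    have "nodes (enc f) \<le> B" using f nodes_encode_fm[of name f] by (simp add: small_def)
    then have "nodes (enc f) * cost 0 \<le> cost 1" using cost_Suc[of _ 0] by simp
    moreover have "nodes (enc f) * 1 \<le> nodes (enc f) * cost 0"
      using cost_pos by (rule mult_le_mono2)
    ultimately show ?thesis using cost_less[of 1 2] cost_pos[of 1] by linarith
  qed
  from member_spec_le[OF this, of "map enc s"]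
  have m: "computes P f_member [enc f, encs s] (truth (enc f \<in> set (map enc s))) ((length s + 1) * cost 2)"
    by simp
  have "(length s + 1) * cost 2 \<le> cost 3"
    using cost_Suc[of "length s + 1" 2] length_lt_B[of s] s by (simp add: state_def)
  note m' = computes_mono[OF m this]
  have "enc f = enc g \<longleftrightarrow> f = g" if "g \<in> set s" for g
  proof (rule inj_on_encode_fm[OF inj])
    show "f \<in> lang \<Phi> A \<G>" using f by (simp add: small_def)
    show "g \<in> lang \<Phi> A \<G>" using that s L_lang by (auto simp: state_def)
  qed
  then have "enc f \<in> set (map enc s) \<longleftrightarrow> f \<in> set s" by auto
  with m' show ?thesis by simp
qed

lemma small_parts:
  "small (Neg f) \<Longrightarrow> small f" "small (Conj f g) \<Longrightarrow> small f" "small (Conj f g) \<Longrightarrow> small g"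
  by (auto simp: small_def elim: lang.cases)

lemma holds_spec_le:
  assumes s: "state s"
  shows "small f \<Longrightarrow> computes P f_holds [encs s, enc f] (truth (holds s f)) (fm_length f * cost 4)"
proof (induction f)
  case (Neg f)
  note IH = Neg.IH[OF small_parts(1)[OF Neg.prems]]
  show ?case
    unfolding computes_def P_holds
    using computesD(2)[OF IH] cost_less[of 0 4] cost_pos[of 0] by (simp add: computesD(1)[OF IH])
next
  case (Conj f g)
  note IH = Conj.IH(1)[OF small_parts(2)[OF Conj.prems]] Conj.IH(2)[OF small_parts(3)[OF Conj.prems]]
  show ?case
    unfolding computes_def P_holds
    using IH[THEN computesD(2)] cost_less[of 0 4] cost_pos[of 0]
    by (simp add: IH[THEN computesD(1)] algebra_simps)
next
  case (Prop p)
  note m = member_spec[OF Prop s]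
  show ?case
    unfolding computes_def P_holds
    using computesD(2)[OF m] cost_less[of 3 4] cost_pos[of 3]
    by (simp add: computesD(1)[OF m, simplified])
next
  case (Know i f)
  note m = member_spec[OF Know.prems s]
  show ?case
    unfolding computes_def P_holds
    using computesD(2)[OF m] cost_less[of 3 4] cost_pos[of 3]
    by (simp add: computesD(1)[OF m, simplified])
next
  case (Everyone G f)
  note m = member_spec[OF Everyone.prems s]
  show ?case
    unfolding computes_def P_holds
    using computesD(2)[OF m] cost_less[of 3 4] cost_pos[of 3]
    by (simp add: computesD(1)[OF m, simplified])
next
  case (Common G f)
  note m = member_spec[OF Common.prems s]
  show ?case
    unfolding computes_def P_holds
    using computesD(2)[OF m] cost_less[of 3 4] cost_pos[of 3]
    by (simp add: computesD(1)[OF m, simplified] add_mult_distrib)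
qed

lemma holds_spec:
  assumes "state s" "small f"
  shows "computes P f_holds [encs s, enc f] (truth (holds s f)) (cost 5)"
  using computes_mono[OF holds_spec_le[OF assms]] cost_Suc[of "fm_length f" 4] assms(2)
  by (simp add: small_def)

text \<open>The set \<open>c\<close> shrinks during the recursion and is therefore generalized. Each
  modal formula costs one evaluation of its obligation and at most two lookups, which take at most
  \<open>K = cost 0\<close> steps each.\<close>

lemma labels_spec_le:
  assumes t: "state t"
  shows "set s \<subseteq> set L \<Longrightarrow> c \<subseteq> A \<Longrightarrow>
     computes P f_labels [code c, encs s, encs t] (code (labels c s t)) ((length s + 1) * cost 6)"
proof (induction s arbitrary: c)
  case Nil
  then show ?case using cost_less[of 0 6] cost_pos[of 0] by (simp add: computes_def P_labels)
next
  case (Cons f s)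
  have f: "f \<in> set L" and s: "set s \<subseteq> set L" using Cons.prems by auto
  note IH = Cons.IH[OF s Cons.prems(2)]
  show ?case
  proof (cases "modal f")
    case True
    note g = group_spec[OF L_lang[OF f] True]
      and h = holds_spec[OF t L_small(2)[OF f True]]
      and d = diff_spec[OF Cons.prems(2) L_small(4)[OF f]]
      and IH' = Cons.IH[OF s, of "c - group f"]
    have c': "c - group f \<subseteq> A" using Cons.prems(2) by auto
    note bounds = computesD(2)[OF g] computesD(2)[OF h] computesD(2)[OF d]
      computesD(2)[OF IH] computesD(2)[OF IH'[OF c']] cost_less[of 5 6] cost_less[of 0 5] cost_pos[of 0] cost_0
    note eqs = computesD(1)[OF g] computesD(1)[OF h] computesD(1)[OF d]
      computesD(1)[OF IH] computesD(1)[OF IH'[OF c']]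
    show ?thesis
      unfolding computes_def P_labels
      using True bounds eqs by (cases f) (simp_all add: obligation_def)
  next
    case False
    then obtain p where p: "f = Prop p" using elems_literal[OF f] by auto
    show ?thesis
      unfolding computes_def P_labels
      using computesD(2)[OF IH] cost_less[of 0 6] cost_pos[of 0]
      by (simp add: computesD(1)[OF IH] p)
  qed
qed

lemma labels_spec:
  assumes "state s" "state t" "c \<subseteq> A"
  shows "computes P f_labels [code c, encs s, encs t] (code (labels c s t)) (cost 7)"
  using computes_mono[OF labels_spec_le[OF assms(2) _ assms(3), of s]]
    cost_Suc[of "length s + 1" 6] length_lt_B[of s] assms(1)
  by (simp add: state_def)

section \<open>Reachability and elimination routines\<close>

lemma hits_spec_le:
  assumes s: "state s" and c: "c \<subseteq> A"
  shows "\<forall>t\<in>set Y. state t \<Longrightarrow>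
     computes P f_hits [code c, encs s, encss Y] (truth (hits c s Y)) ((length Y + 1) * cost 8)"
proof (induction Y)
  case Nil
  then show ?case
    using cost_less[of 0 8] cost_pos[of 0] by (simp add: computes_def P_hits hits_def)
next
  case (Cons t Y)
  then have t: "state t" and IH: "computes P f_hits [code c, encs s, encss Y] (truth (hits c s Y)) ((length Y + 1) * cost 8)"
    by auto
  note l = labels_spec[OF s t c]
  note z = code_eq_0[OF subset_trans[OF labels_subset c], of s t, simplified]
  show ?case
    unfolding computes_def P_hits
    using computesD(2)[OF IH] computesD(2)[OF l] cost_less[of 7 8] cost_pos[of 7]
    by (simp add: computesD(1)[OF IH] computesD(1)[OF l] z hits_def)
qed

lemma list_cost: "m < B \<Longrightarrow> (m + 1) * cost a \<le> cost (Suc a)"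
  by (rule cost_Suc) simp

lemma hits_spec:
  assumes "state s" "c \<subseteq> A" "\<forall>t\<in>set Y. state t" "length Y < B"
  shows "computes P f_hits [code c, encs s, encss Y] (truth (hits c s Y)) (cost 9)"
  using computes_mono[OF hits_spec_le[OF assms(1-3)]] list_cost[OF assms(4), of 8] by simp

lemma hitters_spec_le:
  assumes c: "c \<subseteq> A" and Y: "\<forall>t\<in>set Y. state t" "length Y < B"
  shows "\<forall>t\<in>set W. state t \<Longrightarrow>
     computes P f_hitters [code c, encss W, encss Y, encss Z]
       (encss (filter (\<lambda>u. hits c u Y) W @ Z)) ((length W + 1) * cost 10)"
proof (induction W)
  case Nil
  then show ?case using cost_less[of 0 10] cost_pos[of 0] by (simp add: computes_def P_hitters)
next
  case (Cons s W)
  then have s: "state s" and IH: "computes P f_hitters [code c, encss W, encss Y, encss Z]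
       (encss (filter (\<lambda>u. hits c u Y) W @ Z)) ((length W + 1) * cost 10)"
    by auto
  note h = hits_spec[OF s c Y]
  show ?case
    unfolding computes_def P_hitters
    using computesD(2)[OF IH] computesD(2)[OF h] cost_less[of 9 10] cost_pos[of 9]
    by (simp add: computesD(1)[OF IH] computesD(1)[OF h])
qed

lemma hitters_spec:
  assumes "c \<subseteq> A" "\<forall>t\<in>set Y. state t" "length Y < B" "\<forall>t\<in>set W. state t" "length W < B"
  shows "computes P f_hitters [code c, encss W, encss Y, encss Z]
    (encss (filter (\<lambda>u. hits c u Y) W @ Z)) (cost 11)"
  using computes_mono[OF hitters_spec_le[OF assms(1-4)]] list_cost[OF assms(5), of 10] by simp

lemma reach_states:
  "\<forall>t\<in>set W. state t \<Longrightarrow> \<forall>t\<in>set Y. state t \<Longrightarrow> \<forall>t\<in>set (reach c W Y k). state t"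
  by (cases k) auto

text \<open>The list \<open>xs\<close> is a counter in unary, which allows the list of states itself
  to be passed where \<open>length W\<close> rounds are wanted.\<close>

lemma reach_spec_le:
  assumes c: "c \<subseteq> A" and Y: "\<forall>t\<in>set Y. state t" and W: "\<forall>t\<in>set W. state t"
    and len: "length W + length Y < B"
  shows "computes P f_reach [code c, encss W, encss Y, encode_list xs]
    (encss (reach c W Y (length xs))) ((length xs + 1) * cost 12)"
proof (induction xs)
  case Nil
  then show ?case using cost_less[of 0 12] cost_pos[of 0] by (simp add: computes_def P_reach)
next
  case (Cons x xs)
  have "length (reach c W Y (length xs)) < B"
    using reach_length_le len by (rule le_less_trans)
  then have h: "computes P f_hitters [code c, encss W, encss (reach c W Y (length xs)), encss Y]
      (encss (filter (\<lambda>u. hits c u (reach c W Y (length xs))) W @ Y)) (cost 11)"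
    by (intro hitters_spec c W reach_states Y) (use len in auto)
  show ?case
    unfolding computes_def P_reach
    using computesD(2)[OF Cons] computesD(2)[OF h] cost_less[of 11 12] cost_pos[of 11]
    by (simp add: computesD(1)[OF Cons] computesD(1)[OF h, simplified])
qed

lemma reach_spec:
  assumes "c \<subseteq> A" "\<forall>t\<in>set Y. state t" "\<forall>t\<in>set W. state t" "length W + length Y < B" "length xs < B"
  shows "computes P f_reach [code c, encss W, encss Y, encode_list xs]
    (encss (reach c W Y (length xs))) (cost 13)"
  using computes_mono[OF reach_spec_le[OF assms(1-4)]] list_cost[OF assms(5), of 12] by simp

lemma refuters_spec_le:
  assumes f: "small f"
  shows "\<forall>t\<in>set W. state t \<Longrightarrow>
     computes P f_refuters [enc f, encss W] (encss (filter (\<lambda>t. \<not> holds t f) W)) ((length W + 1) * cost 6)"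
proof (induction W)
  case Nil
  then show ?case using cost_less[of 0 6] cost_pos[of 0] by (simp add: computes_def P_refuters)
next
  case (Cons s W)
  then have s: "state s" and IH: "computes P f_refuters [enc f, encss W]
      (encss (filter (\<lambda>t. \<not> holds t f) W)) ((length W + 1) * cost 6)"
    by auto
  note h = holds_spec[OF s f]
  show ?case
    unfolding computes_def P_refuters
    using computesD(2)[OF IH] computesD(2)[OF h] cost_less[of 5 6] cost_pos[of 5]
    by (simp add: computesD(1)[OF IH] computesD(1)[OF h])
qed

lemma refuters_spec:
  assumes "small f" "\<forall>t\<in>set W. state t" "length W < B"
  shows "computes P f_refuters [enc f, encss W] (encss (filter (\<lambda>t. \<not> holds t f) W)) (cost 7)"
  using computes_mono[OF refuters_spec_le[OF assms(1,2)]] list_cost[OF assms(3), of 6] by simp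

definition states_list :: "(nat, nat) fm list list \<Rightarrow> bool" where
  "states_list W \<longleftrightarrow> (\<forall>t\<in>set W. state t) \<and> length W \<le> 2 ^ fm_length \<phi>"

lemma fulfilled_simps:
  "fulfilled [] W s"
  "fulfilled (f # fs) W s \<longleftrightarrow> (modal f \<longrightarrow> f \<in> set s \<or> refuted W s f) \<and> fulfilled fs W s"
  by (auto simp: fulfilled_def)

lemma fulfilled_spec_le:
  assumes s: "state s" and W: "states_list W"
  shows "set fs \<subseteq> set L \<Longrightarrow>
     computes P f_fulfilled [encode_list (map enc fs), encss W, encs s]
       (truth (fulfilled fs W s)) ((length fs + 1) * cost 14)"
proof (induction fs)
  case Nil
  then show ?case
    using cost_less[of 0 14] cost_pos[of 0] by (simp add: computes_def P_fulfilled fulfilled_simps)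
next
  case (Cons f fs)
  have f: "f \<in> set L" using Cons.prems by auto
  have IH: "computes P f_fulfilled [encode_list (map enc fs), encss W, encs s]
       (truth (fulfilled fs W s)) ((length fs + 1) * cost 14)"
    using Cons by auto
  have WB: "\<forall>t\<in>set W. state t" "length W < B"
    using W by (auto simp: states_list_def intro: lengths_lt_B)
  show ?case
  proof (cases "modal f")
    case True
    let ?Y = "filter (\<lambda>t. \<not> holds t (arg f)) W"
    \<comment> \<open>This is the counter passed to \<open>f_reach\<close>: \<open>W\<close> itself
      for \<open>Common\<close>, and the empty list where a single step refutes.\<close>
    let ?xs = "if common f then map encs W else []"
    have "length ?Y \<le> length W" by (rule length_filter_le)
    with W have "length W + length ?Y \<le> 2 * 2 ^ fm_length \<phi>"
      unfolding states_list_def by linarith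
    then have len: "length W + length ?Y < B" by (rule lengths_lt_B)
    have xs: "length ?xs < B" using WB(2) by auto
    have Y: "\<forall>t\<in>set ?Y. state t" using WB by auto
    note m = member_spec[OF L_small(1)[OF f] s]
      and g = group_spec[OF L_lang[OF f] True]
      and n = refuters_spec[OF L_small(3)[OF f True] WB]
      and r = reach_spec[OF L_small(4)[OF f] Y WB(1) len xs]
      and h = hits_spec[OF s L_small(4)[OF f] reach_states[OF WB(1) Y]
        le_less_trans[OF reach_length_le len], of "group f" "length ?xs"]
    note bounds = computesD(2)[OF m] computesD(2)[OF g] computesD(2)[OF n]
      computesD(2)[OF r] computesD(2)[OF h] computesD(2)[OF IH]
      cost_less[of 13 14] cost_less[of 9 13] cost_less[of 7 9] cost_less[of 3 7] cost_less[of 0 3] cost_pos[of 0] cost_0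
    note eqs = computesD(1)[OF m] computesD(1)[OF g] computesD(1)[OF n]
      computesD(1)[OF r] computesD(1)[OF h] computesD(1)[OF IH]
    show ?thesis
      unfolding computes_def P_fulfilled
      using True bounds eqs by (cases f) (simp_all add: fulfilled_simps refuted_def)
  next
    case False
    then obtain p where p: "f = Prop p" using elems_literal[OF f] by auto
    show ?thesis
      unfolding computes_def P_fulfilled
      using computesD(2)[OF IH] cost_less[of 0 14] cost_pos[of 0]
      by (simp add: computesD(1)[OF IH] p fulfilled_simps)
  qed
qed

lemma length_L_less_B: "length L < B"
  using length_elems by (rule length_lt_B)

lemma fulfilled_spec:
  assumes "state s" "states_list W"
  shows "computes P f_fulfilled [encs L, encss W, encs s] (truth (fulfilled L W s)) (cost 15)"
  using computes_mono[OF fulfilled_spec_le[OF assms subset_refl]] list_cost[OF length_L_less_B, of 14]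
  by simp

lemma round_spec_le:
  assumes W: "states_list W"
  shows "\<forall>t\<in>set X. state t \<Longrightarrow>
     computes P f_round [encs L, encss W, encss X] (encss (filter (fulfilled L W) X))
       ((length X + 1) * cost 16)"
proof (induction X)
  case Nil
  then show ?case using cost_less[of 0 16] cost_pos[of 0] by (simp add: computes_def P_round)
next
  case (Cons s X)
  then have s: "state s" and IH: "computes P f_round [encs L, encss W, encss X]
      (encss (filter (fulfilled L W) X)) ((length X + 1) * cost 16)"
    by auto
  note h = fulfilled_spec[OF s W]
  show ?case
    unfolding computes_def P_round
    using computesD(2)[OF IH] computesD(2)[OF h] cost_less[of 15 16] cost_pos[of 15]
    by (simp add: computesD(1)[OF IH] computesD(1)[OF h])
qed

lemma states_listD: "states_list W \<Longrightarrow> \<forall>t\<in>set W. state t" "states_list W \<Longrightarrow> length W < B"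
  by (auto simp: states_list_def intro: lengths_lt_B)

lemma states_list_filter: "states_list W \<Longrightarrow> states_list (filter p W)"
  by (auto simp: states_list_def intro: order_trans[OF length_filter_le])

lemma round_spec:
  assumes "states_list W"
  shows "computes P f_round [encs L, encss W, encss W] (encss (filter (fulfilled L W) W)) (cost 17)"
  using computes_mono[OF round_spec_le[OF assms states_listD(1)[OF assms]]]
    list_cost[OF states_listD(2)[OF assms], of 16]
  by simp

lemma eliminate_spec_le:
  "states_list W \<Longrightarrow>
     computes P f_eliminate [encode_list xs, encs L, encss W] (encss (eliminate (length xs) L W))
       ((length xs + 1) * cost 18)"
proof (induction xs arbitrary: W)
  case Nil
  then show ?case using cost_less[of 0 18] cost_pos[of 0] by (simp add: computes_def P_eliminate)
next
  case (Cons x xs)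
  note r = round_spec[OF Cons.prems]
    and IH = Cons.IH[OF states_list_filter[OF Cons.prems], of "fulfilled L W"]
  show ?case
    unfolding computes_def P_eliminate
    using computesD(2)[OF IH] computesD(2)[OF r] cost_less[of 17 18] cost_pos[of 17]
    by (simp add: computesD(1)[OF IH] computesD(1)[OF r])
qed

lemma eliminate_spec:
  assumes "states_list W"
  shows "computes P f_eliminate [encss W, encs L, encss W] (encss (eliminate (length W) L W)) (cost 19)"
  using computes_mono[OF eliminate_spec_le[OF assms, of "map encs W"]]
    list_cost[OF states_listD(2)[OF assms], of 18]
  by simp

lemma candidates_spec_le:
  "\<forall>t\<in>set X. state t \<Longrightarrow>
     computes P f_candidates [encss X] (encss (filter (\<lambda>s. labels R s s = R) X))
       ((length X + 1) * cost 8)"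
proof (induction X)
  case Nil
  then show ?case using cost_less[of 0 8] cost_pos[of 0] by (simp add: computes_def P_candidates)
next
  case (Cons s X)
  then have s: "state s" and IH: "computes P f_candidates [encss X]
      (encss (filter (\<lambda>s. labels R s s = R) X)) ((length X + 1) * cost 8)"
    by auto
  note l = labels_spec[OF s s R] and eq = code_eq[OF subset_trans[OF labels_subset R] R, of s s]
  show ?case
    unfolding computes_def P_candidates
    using computesD(2)[OF IH] computesD(2)[OF l] cost_less[of 7 8] cost_pos[of 7]
    by (simp add: computesD(1)[OF IH] computesD(1)[OF l] eq)
qed

section \<open>Generation of the states and the main function\<close>

lemma extend_spec_le:
  "computes P f_extend [x, encode_list (map encode_list xss), encode_list (map encode_list yss)]
     (encode_list (map encode_list (map ((#) x) xss @ yss))) ((length xss + 1) * cost 1)"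
proof (induction xss)
  case Nil
  then show ?case using cost_less[of 0 1] cost_pos[of 0] by (simp add: computes_def P_extend)
next
  case (Cons xs xss)
  show ?case
    unfolding computes_def P_extend
    using computesD(2)[OF Cons] cost_less[of 0 1] cost_pos[of 0]
    by (simp add: computesD(1)[OF Cons, simplified])
qed

lemma sublists_spec_le:
  "length xs \<le> fm_length \<phi> \<Longrightarrow>
     computes P f_sublists [encode_list xs] (encode_list (map encode_list (sublists xs)))
       ((length xs + 1) * cost 3)"
proof (induction xs)
  case Nil
  then show ?case using cost_less[of 0 3] cost_pos[of 0] by (simp add: computes_def P_sublists)
next
  case (Cons x xs)
  then have IH: "computes P f_sublists [encode_list xs] (encode_list (map encode_list (sublists xs)))
      ((length xs + 1) * cost 3)"
    by simp
  have "(2::nat) ^ length xs \<le> 2 ^ fm_length \<phi>"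
    using Cons.prems by (intro power_increasing) auto
  then have "length (sublists xs) + 1 \<le> B"
    using fm_length_less unfolding B length_sublists by linarith
  then have "(length (sublists xs) + 1) * cost 1 \<le> cost (Suc 1)" by (rule cost_Suc)
  then have e: "computes P f_extend [x, encode_list (map encode_list (sublists xs)),
      encode_list (map encode_list (sublists xs))]
     (encode_list (map encode_list (sublists (x # xs)))) (cost 2)"
    using computes_mono[OF extend_spec_le[of x "sublists xs" "sublists xs"]] by (simp add: numeral_2_eq_2)
  show ?case
    unfolding computes_def P_sublists
    using computesD(2)[OF IH] computesD(2)[OF e] cost_less[of 2 3] cost_pos[of 2]
    by (simp add: computesD(1)[OF IH] computesD(1)[OF e, simplified])
qed

text \<open>An accumulator takes the place of concatenation, so the bound is proportional to the
  length of \<open>f\<close>.\<close>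

lemma elems_spec_le:
  "computes P f_elems [enc f, encode_list xs] (encode_list (map enc (elems f) @ xs))
     (fm_length f * cost 1)"
proof (induction f arbitrary: xs)
  case (Conj f g)
  note IH = Conj(1)[of "map enc (elems g) @ xs"] Conj(2)[of xs]
  show ?case
    unfolding computes_def P_elems
    using IH[THEN computesD(2)] cost_less[of 0 1] cost_pos[of 0]
    by (simp add: IH[THEN computesD(1)] add_mult_distrib)
next
  case (Neg f)
  show ?case
    unfolding computes_def P_elems
    using computesD(2)[OF Neg[of xs]] cost_less[of 0 1] cost_pos[of 0]
    by (simp add: computesD(1)[OF Neg] add_mult_distrib)
next
  case (Know i f)
  show ?case
    unfolding computes_def P_elems
    using computesD(2)[OF Know[of xs]] cost_less[of 0 1] cost_pos[of 0]
    by (simp add: computesD(1)[OF Know] add_mult_distrib)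
next
  case (Everyone G f)
  show ?case
    unfolding computes_def P_elems
    using computesD(2)[OF Everyone[of xs]] cost_less[of 0 1] cost_pos[of 0]
    by (simp add: computesD(1)[OF Everyone] add_mult_distrib)
next
  case (Common G f)
  show ?case
    unfolding computes_def P_elems
    using computesD(2)[OF Common[of xs]] cost_less[of 0 1] cost_pos[of 0]
    by (simp add: computesD(1)[OF Common] add_mult_distrib)
next
  case (Prop p)
  show ?case
    using cost_less[of 0 1] cost_pos[of 0] by (simp add: computes_def P_elems)
qed

lemma elems_spec: "computes P f_elems [enc \<phi>, Num 0] (encs L) (cost 2)"
  using computes_mono[OF elems_spec_le[of \<phi> "[]"], of "cost 2"]
    cost_Suc[of "fm_length \<phi>" 1] fm_length_le_B[of \<phi>]
  by (simp add: numeral_2_eq_2)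

lemma sublists_spec: "computes P f_sublists [encs L] (encss (sublists L)) (cost 4)"
proof -
  \<comment> \<open>The program forms sublists of codes, so \<open>sublists\<close> has to commute
    with coding the entries.\<close>
  have "sublists (map f xs) = map (map f) (sublists xs)" for f :: "(nat, nat) fm \<Rightarrow> data" and xs
    by (induction xs) auto
  then have "map encode_list (sublists (map enc L)) = map encs (sublists L)" by simp
  with computes_mono[OF sublists_spec_le[of "map enc L"], of "cost 4"] length_elems[of \<phi>]
    list_cost[OF length_L_less_B, of 3]
  show ?thesis by simp
qed

lemma states_list_sublists: "states_list (sublists L)"
proof -
  have "(2::nat) ^ length L \<le> 2 ^ fm_length \<phi>"
    using length_elems by (intro power_increasing) auto
  then show ?thesis
    using length_elems[of \<phi>]
    by (auto simp: states_list_def length_sublists state_def dest!: sublists_bounds)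
qed

lemma candidates_spec: "computes P f_candidates [encss (sublists L)] (encss (candidates R L)) (cost 9)"
  using computes_mono[OF candidates_spec_le[OF states_listD(1)[OF states_list_sublists]], of "cost 9"]
    list_cost[OF states_listD(2)[OF states_list_sublists], of 8]
  by (simp add: candidates_def)

lemma main_spec:
  "computes P 0 [enc \<phi>] (truth (\<exists>s\<in>set (survivors R \<phi>). holds s \<phi>)) (cost 20)"
proof -
  have W: "states_list (candidates R L)"
    unfolding candidates_def by (rule states_list_filter[OF states_list_sublists])
  have "states_list (eliminate k L V)" if "states_list V" for k V
    using that by (induction k arbitrary: V) (auto intro: states_list_filter)
  then have S: "states_list (survivors R \<phi>)" using W by (simp add: survivors_def Let_def)
  \<comment> \<open>The main function looks for survivors refuting \<open>Neg \<phi>\<close>, so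
    this formula must obey the size bound.\<close>
  have "small (Neg \<phi>)"
  proof -
    have "fm_length (Neg \<phi>) \<le> 2 * fm_length \<phi>" by (cases \<phi>) auto
    from fm_length_le_B[OF this] \<phi> show ?thesis unfolding small_def by (blast intro: lang.intros)
  qed
  note n = refuters_spec[OF this states_listD[OF S]]
    and e = eliminate_spec[OF W, folded survivors_def[of R \<phi>, unfolded Let_def]]
  note specs = elems_spec sublists_spec candidates_spec e n
  have "filter (\<lambda>s. holds s \<phi>) V = [] \<longleftrightarrow> \<not> (\<exists>s\<in>set V. holds s \<phi>)" for V
    by (simp add: filter_empty_conv)
  moreover have "apply_prim IS_NUM [encss V] = Some (truth (V = []))" for V by (cases V) auto
  ultimately show ?thesis
    unfolding computes_def P_main
    using specs[THEN computesD(2)] cost_less[of 2 4] cost_less[of 4 7] cost_less[of 7 9]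
      cost_less[of 9 19] cost_less[of 19 20] cost_pos[of 2]
    by (auto simp: specs[THEN computesD(1), simplified] split: data.splits)
qed

end

section \<open>Group operations by table lookup\<close>

text \<open>A tree searching for the code of \<open>c\<close> has at its leaves trees searching for
  the code of \<open>c'\<close>. There are at most \<open>2 ^ card A\<close> codes, so each search
  adds at most \<open>4 * card A\<close> steps to the one step for the final literal.\<close>

lemma diff_table:
  assumes A: "finite A"
  shows "\<exists>dif. \<forall>c c'. c \<subseteq> A \<longrightarrow> c' \<subseteq> A \<longrightarrow> (\<forall>P. \<exists>n \<le> 1 + 8 * card A.
    eval P [Num (set_encode c), Num (set_encode c')] dif (Num (set_encode (c - c'))) n)"
proof -
  let ?X = "set_encode ` Pow A"
  have fin: "finite ?X" using A by simp
  have "card ?X \<le> card (Pow A)" using A by (intro card_image_le) simp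
  then have card: "card ?X \<le> 2 ^ card A" using A by (simp add: card_Pow)
  let ?e = "\<lambda>x y. Lit (set_encode (set_decode x - set_decode y))"
  define T where "T x b \<longleftrightarrow> (\<forall>y\<in>?X. \<forall>P env v n. 1 < length env \<longrightarrow> env ! 1 = Num y \<longrightarrow>
     eval P env (?e x y) v n \<longrightarrow> (\<exists>m \<le> n + 4 * card A. eval P env b v m))" for x b
  have "\<forall>x. \<exists>b. T x b" unfolding T_def by (intro allI decision_tree[OF fin card])
  then obtain b where T: "\<And>x. T x (b x)" by metis
  obtain dif where dif: "\<And>x P env v n. x \<in> ?X \<Longrightarrow> 0 < length env \<Longrightarrow> env ! 0 = Num x \<Longrightarrow>
     eval P env (b x) v n \<Longrightarrow> \<exists>m \<le> n + 4 * card A. eval P env dif v m"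
    using decision_tree[OF fin card, of 0 b] by blast
  show ?thesis
  proof (intro exI[of _ dif] allI impI)
    fix c c' P
    assume c: "c \<subseteq> A" "c' \<subseteq> A"
    then have "finite c" "finite c'" using A finite_subset by auto
    let ?x = "set_encode c" and ?y = "set_encode c'"
    have lit: "eval P [Num ?x, Num ?y] (?e ?x ?y) (Num (set_encode (c - c'))) 1"
      using eval_evals.Lit[of P "[Num ?x, Num ?y]" "set_encode (c - c')"] \<open>finite c\<close> \<open>finite c'\<close>
      by simp
    have X: "?x \<in> ?X" "?y \<in> ?X" using c by auto
    from T[of ?x, unfolded T_def, rule_format, OF X(2) _ _ lit]
    obtain m where m: "m \<le> 1 + 4 * card A"
      "eval P [Num ?x, Num ?y] (b ?x) (Num (set_encode (c - c'))) m"
      by auto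
    from dif[OF X(1) _ _ m(2)] obtain m' where "m' \<le> m + 4 * card A"
      "eval P [Num ?x, Num ?y] dif (Num (set_encode (c - c'))) m'"
      by auto
    with m(1) show "\<exists>n \<le> 1 + 8 * card A.
        eval P [Num ?x, Num ?y] dif (Num (set_encode (c - c'))) n"
      by (intro exI[of _ m']) auto
  qed
qed

text \<open>Since \<open>\<G>\<close> is contained in \<open>Pow A\<close>, at most
  \<open>2 ^ card A\<close> names occur, and a search among them has depth \<open>card A\<close>.
  Agents are searched for in a second tree.\<close>

lemma group_table:
  assumes A: "finite A" and \<G>: "\<And>G. G \<in> \<G> \<Longrightarrow> G \<subseteq> A" and inj: "inj_on name \<G>"
  shows "\<exists>grp. \<forall>f \<in> lang \<Phi> A \<G>. modal f \<longrightarrow> (\<forall>P. \<exists>n \<le> 10 + 4 * card A.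
    eval P [encode_fm name f] grp (Num (set_encode (group f))) n)"
proof -
  have \<G>A: "\<G> \<subseteq> Pow A" using \<G> by auto
  then have fin: "finite \<G>" using A by (auto intro: finite_subset)
  have "card (name ` \<G>) \<le> card \<G>" using fin by (rule card_image_le)
  also have "\<dots> \<le> 2 ^ card A" using card_mono[OF _ \<G>A] A by (simp add: card_Pow)
  finally have card: "card (name ` \<G>) \<le> 2 ^ card A" .
  obtain a where a: "\<And>i P env v n. i \<in> A \<Longrightarrow> 0 < length env \<Longrightarrow> env ! 0 = Num i \<Longrightarrow>
     eval P env (Lit (set_encode {i})) v n \<Longrightarrow> \<exists>m \<le> n + 4 * card A. eval P env a v m"
    using decision_tree[OF A less_imp_le[OF less_exp], of 0 "\<lambda>i. Lit (set_encode {i})"] by blast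
  let ?g = "\<lambda>k. Lit (set_encode (inv_into \<G> name k))"
  obtain g where g: "\<And>k P env v n. k \<in> name ` \<G> \<Longrightarrow> 0 < length env \<Longrightarrow> env ! 0 = Num k \<Longrightarrow>
     eval P env (?g k) v n \<Longrightarrow> \<exists>m \<le> n + 4 * card A. eval P env g v m"
    using decision_tree[OF finite_imageI[OF fin] card, of 0 ?g] by blast
  have agent: "\<exists>m \<le> 1 + 4 * card A. eval P (Num i # env) a (Num (set_encode {i})) m"
    if "i \<in> A" for i P env
    using a[OF that _ _ eval_evals.Lit, of "Num i # env" P] by simp
  have named: "\<exists>m \<le> 1 + 4 * card A. eval P (Num (name G) # env) g (Num (set_encode G)) m"
    if "G \<in> \<G>" for G P env
  proof -
    have "eval P (Num (name G) # env) (?g (name G)) (Num (set_encode G)) 1"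
      using eval_evals.Lit[of P _ "set_encode G"] inv_into_f_f[OF inj that] by simp
    from g[OF imageI[OF that] _ _ this] show ?thesis by simp
  qed
  \<comment> \<open>The agent or name is bound first, as both trees inspect \<open>Var 0\<close>;
    the tag of the formula, now \<open>Var 1\<close>, selects the tree. Nine steps go into this
    dispatch and one into the literal at the leaf.\<close>
  have "\<exists>n \<le> 10 + 4 * card A. eval P [encode_fm name f]
      (Bind (Head (Tail (Var 0))) (Cond (Tagged (Var 1) 3) a g)) (Num (set_encode (group f))) n"
    if "f \<in> lang \<Phi> A \<G>" "modal f" for f P
  proof -
    have "wp P [encode_fm name f] (Bind (Head (Tail (Var 0))) (Cond (Tagged (Var 1) 3) a g))
        (\<lambda>v n. v = Num (set_encode (group f)) \<and> n \<le> 10 + 4 * card A)"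
      using that
    proof cases
      case (4 i \<psi>)
      then show ?thesis using agent[of i P "[encode_fm name f]"] by (auto simp: wp_def[of _ _ a])
    next
      case (5 G \<psi>)
      then show ?thesis using named[of G P "[encode_fm name f]"] by (auto simp: wp_def[of _ _ g])
    next
      case (6 G \<psi>)
      then show ?thesis using named[of G P "[encode_fm name f]"] by (auto simp: wp_def[of _ _ g])
    qed auto
    then show ?thesis unfolding wp_def by blast
  qed
  then show ?thesis by blast
qed

section \<open>The decision procedure and its running time\<close>

lemma decision_procedure:
  assumes inf: "infinite (UNIV :: 's set)" and A: "finite A" "A \<noteq> {}"
    and \<G>: "\<And>G. G \<in> \<G> \<Longrightarrow> G \<subseteq> A" and inj: "inj_on name \<G>" and cases: "R = {} \<or> R = A"
  shows "\<exists>Q. decides_in_time Q (lang \<Phi> A \<G>) (encode_fm name)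
    (satisfiable_in (structures A R :: ('s, nat, nat) kripke set))
    (\<lambda>\<phi>. 24 * 2 ^ 120 * real (card A) * 2 powr (20 * real (fm_length \<phi>)))"
proof -
  from diff_table[OF A(1)] obtain dif where dif: "\<forall>c c'. c \<subseteq> A \<longrightarrow> c' \<subseteq> A \<longrightarrow> (\<forall>P. \<exists>n \<le> 1 + 8 * card A.
    eval P [Num (set_encode c), Num (set_encode c')] dif (Num (set_encode (c - c'))) n)" ..
  from group_table[OF A(1) \<G> inj] obtain grp where grp: "\<forall>f \<in> lang \<Phi> A \<G>. modal f \<longrightarrow> (\<forall>P. \<exists>n \<le> 10 + 4 * card A.
    eval P [encode_fm name f] grp (Num (set_encode (group f))) n)" ..
  define P where "P = program (set_encode R) grp dif"
  \<comment> \<open>Since \<open>A\<close> is nonempty, additive constants are absorbed by multiples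
    of \<open>card A\<close>.\<close>
  have a: "1 \<le> card A" using A by (simp add: Suc_le_eq card_gt_0_iff)
  have le: "computes P f vs r (24 * card A)" if "eval P vs (P ! f) r n" "n \<le> 10 + 8 * card A" for f vs r n
    using that a unfolding computes_def wp_def by (intro exI[of _ r] exI[of _ n]) auto
  have group_le: "computes P f_group [encode_fm name f] (Num (set_encode (group f))) (24 * card A)"
    if f: "f \<in> lang \<Phi> A \<G>" "modal f" for f
  proof -
    obtain n where n: "n \<le> 10 + 4 * card A"
      "eval P [encode_fm name f] grp (Num (set_encode (group f))) n"
      using grp[rule_format, OF f] by blast
    show ?thesis
      by (rule le[of _ _ _ n]) (use n group_code[of "set_encode R" grp dif, folded P_def] in simp_all)
  qed
  have diff_le: "computes P f_diff [Num (set_encode c), Num (set_encode c')]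
      (Num (set_encode (c - c'))) (24 * card A)" if c: "c \<subseteq> A" "c' \<subseteq> A" for c c'
  proof -
    obtain n where n: "n \<le> 1 + 8 * card A"
      "eval P [Num (set_encode c), Num (set_encode c')] dif (Num (set_encode (c - c'))) n"
      using dif[rule_format, OF c] by blast
    show ?thesis
      by (rule le[of _ _ _ n]) (use n diff_code[of "set_encode R" grp dif, folded P_def] in simp_all)
  qed
  have "\<exists>n. runs P (encode_fm name \<phi>)
      (Num (if satisfiable_in (structures A R :: ('s, nat, nat) kripke set) \<phi> then 1 else 0)) n \<and>
      real n \<le> 24 * 2 ^ 120 * real (card A) * 2 powr (20 * real (fm_length \<phi>))"
    if \<phi>: "\<phi> \<in> lang \<Phi> A \<G>" for \<phi>
  proof -
    \<comment> \<open>\<open>P\<close> was fixed before \<open>\<phi>\<close>; the locale is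
      instantiated for each input to obtain its bounds.\<close>
    interpret decider \<Phi> A \<G> name \<phi> R grp dif "24 * card A" "64 * 2 ^ fm_length \<phi>" P
      by unfold_locales (use A(1) \<G> inj cases \<phi> a P_def group_le diff_le in auto)
    obtain n where n: "eval P [encode_fm name \<phi>] (P ! 0)
        (truth (\<exists>s\<in>set (survivors R \<phi>). holds s \<phi>)) n" "n \<le> cost 20"
      using main_spec unfolding computes_def wp_def by blast
    \<comment> \<open>This is \<open>K * B ^ 20\<close> with \<open>K = 24 * card A\<close> and
      \<open>B = 64 * 2 ^ fm_length \<phi>\<close>.\<close>
    have "real (cost 20) = 24 * real (card A) * (64 ^ 20 * (2 ^ fm_length \<phi>) ^ 20)"
      by (simp add: cost_def power_mult_distrib)
    also have "(64::real) ^ 20 = 2 ^ 120" by simp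
    also have "((2::real) ^ fm_length \<phi>) ^ 20 = 2 powr (20 * real (fm_length \<phi>))"
      using powr_realpow[of 2 "20 * fm_length \<phi>"] by (simp add: power_mult[symmetric] mult.commute)
    finally have "real n \<le> 24 * 2 ^ 120 * real (card A) * 2 powr (20 * real (fm_length \<phi>))"
      using n(2) by (simp add: mult_ac)
    moreover have "runs P (encode_fm name \<phi>)
      (Num (if satisfiable_in (structures A R :: ('s, nat, nat) kripke set) \<phi> then 1 else 0)) n"
    proof -
      have "P \<noteq> []" by (simp add: P_def program_def)
      moreover have "satisfiable_in (structures A R :: ('s, nat, nat) kripke set) \<phi> \<longleftrightarrow>
          (\<exists>s\<in>set (survivors R \<phi>). holds s \<phi>)"
        by (rule survivors_correct[OF inf \<phi> assms(4) cases])
      ultimately show ?thesis using n(1) by (simp add: runs_def)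
    qed
    ultimately show ?thesis by blast
  qed
  then show ?thesis unfolding decides_in_time_def by blast
qed

theorem theorem4p5:
  assumes "infinite (UNIV :: 's set)"
  shows "\<exists>c::real. c > 0 \<and> (\<forall>a::real. \<exists>d::real.
    \<forall>(\<Phi> :: nat set) (A :: nat set) (\<G> :: nat set set) (name :: nat set \<Rightarrow> nat).
      finite A \<and> A \<noteq> {} \<and> (\<forall>G\<in>\<G>. G \<noteq> {} \<and> G \<subseteq> A) \<and> inj_on name \<G> \<and>
      (\<exists>P. decides_in_time P (A \<times> \<G>) (encode_query name) (\<lambda>(i, G). i \<in> G)
             (\<lambda>_. a * real (card A)))
      \<longrightarrow>
      (\<exists>Q. decides_in_time Q (lang \<Phi> A \<G>) (encode_fm name)
             (satisfiable_in (kripke_structures A :: ('s, nat, nat) kripke set))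
             (\<lambda>\<phi>. d * real (card A) * 2 powr (c * real (fm_length \<phi>)))) \<and>
      (\<exists>Q. decides_in_time Q (lang \<Phi> A \<G>) (encode_fm name)
             (satisfiable_in (reflexive_structures A :: ('s, nat, nat) kripke set))
             (\<lambda>\<phi>. d * real (card A) * 2 powr (c * real (fm_length \<phi>)))))"
proof (rule exI[of _ 20], rule conjI, simp, rule allI, rule exI[of _ "24 * 2 ^ 120"],
    intro allI impI, elim conjE, rule conjI)
  fix \<Phi> A :: "nat set" and \<G> :: "nat set set" and name :: "nat set \<Rightarrow> nat"
  assume A: "finite A" "A \<noteq> {}" and \<G>: "\<forall>G\<in>\<G>. G \<noteq> {} \<and> G \<subseteq> A" and inj: "inj_on name \<G>"
  have proc: "\<exists>Q. decides_in_time Q (lang \<Phi> A \<G>) (encode_fm name)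
      (satisfiable_in (structures A R :: ('s, nat, nat) kripke set))
      (\<lambda>\<phi>. 24 * 2 ^ 120 * real (card A) * 2 powr (20 * real (fm_length \<phi>)))"
    if "R = {} \<or> R = A" for R
    by (rule decision_procedure[OF assms A _ inj that]) (use \<G> in blast)
  show "\<exists>Q. decides_in_time Q (lang \<Phi> A \<G>) (encode_fm name)
      (satisfiable_in (kripke_structures A :: ('s, nat, nat) kripke set))
      (\<lambda>\<phi>. 24 * 2 ^ 120 * real (card A) * 2 powr (20 * real (fm_length \<phi>)))"
    using proc[of "{}"] by (simp only: structures_empty simp_thms)
  show "\<exists>Q. decides_in_time Q (lang \<Phi> A \<G>) (encode_fm name)
      (satisfiable_in (reflexive_structures A :: ('s, nat, nat) kripke set))
      (\<lambda>\<phi>. 24 * 2 ^ 120 * real (card A) * 2 powr (20 * real (fm_length \<phi>)))"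
    using proc[of A] by (simp only: structures_full simp_thms)
qed

end
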